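(* Let $\mathbf{k}$ be a commutative ring and let $H$ be a graded $\mathbf{k}$-bialgebra. Let $\alpha=(\alpha_1,\ldots,\alpha_k)$ be a weak composition and $\sigma\in\mathfrak{S}_k$ a permutation. Let $\beta=(\beta_1,\ldots,\beta_\ell)$ be a weak composition and $\tau\in\mathfrak{S}_\ell$ a permutation. Let $\alpha\beta$ be the concatenation $(\alpha_1,\ldots,\alpha_k,\beta_1,\ldots,\beta_\ell)$. Let $\sigma\oplus\tau\in\mathfrak{S}_{k+\ell}$ be the permutation of $[k+\ell]$ that sends each $i\le k$ to $\sigma(i)$ and each $j>k$ to $k+\tau(j-k)$. Then $$p_{\alpha,\sigma}\star p_{\beta,\tau}=p_{\alpha\beta,\ \sigma\oplus\tau}.$$
   Context: $\mathbb{N}=\{0,1,2,\ldots\}$; $[k]=\{1,2,\ldots,k\}$; $\mathfrak{S}_k$ is the group of permutations of $[k]$. All modules, algebras, bialgebras and tensor products are over the commutative ring $\mathbf{k}$; algebras are associative and unital. "Graded" means $\mathbb{N}$-graded; a graded bialgebra $H=\bigoplus_{n\in\mathbb{N}}H_n$ is a bialgebra whose multiplication, unit, comultiplication and counit are graded maps (no sign twists in tensor products; $H$ is not required to be connected). $p_n:H\to H$ is the canonical projection onto the $n$-th graded component $H_n$. The maps $m^{[k]}:H^{\otimes k}\to H$ and $\Delta^{[k]}:H\to H^{\otimes k}$ are the $k$-fold iterated multiplication and comultiplication ($m^{[k]}(a_1\otimes\cdots\otimes a_k)=a_1\cdots a_k$, $\Delta^{[k]}(x)=\sum_{(x)}x_{(1)}\otimes\cdots\otimes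 x_{(k)}$; $m^{[0]}=u$ is the unit map, $\Delta^{[0]}=\epsilon$ is the counit). The group $\mathfrak{S}_k$ acts on $H^{\otimes k}$ from the left by $\sigma\cdot(h_1\otimes\cdots\otimes h_k)=h_{\sigma^{-1}(1)}\otimes\cdots\otimes h_{\sigma^{-1}(k)}$. A weak composition is a finite tuple of nonnegative integers. For a weak composition $\alpha=(\alpha_1,\ldots,\alpha_k)$, let $P_\alpha:=p_{\alpha_1}\otimes\cdots\otimes p_{\alpha_k}$. For $\alpha\in\mathbb{N}^k$ and $\sigma\in\mathfrak{S}_k$, define $p_{\alpha,\sigma}:=m^{[k]}\circ P_\alpha\circ\sigma^{-1}\circ\Delta^{[k]}:H\to H$, where $\sigma^{-1}$ means the action of $\sigma^{-1}$ on $H^{\otimes k}$. The convolution of $f,g\in\operatorname{End}H$ ($\mathbf{k}$-linear endomorphisms) is $f\star g:=m\circ(f\otimes g)\circ\Delta$. *)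

theory Defs
  imports "HOL-Algebra.Module" "HOL-Algebra.AbelCoset" "HOL-Combinatorics.Permutations"
begin

section \<open>Linear maps, free modules and quotient modules\<close>

definition linear_maps ::
    "('k, 'r) ring_scheme \<Rightarrow> ('k, 'a, 'm) module_scheme \<Rightarrow> ('k, 'b, 'n) module_scheme \<Rightarrow> ('a \<Rightarrow> 'b) set"
  where "linear_maps R M N = {f \<in> carrier M \<rightarrow> carrier N.
    (\<forall>x\<in>carrier M. \<forall>y\<in>carrier M. f (x \<oplus>\<^bsub>M\<^esub> y) = f x \<oplus>\<^bsub>N\<^esub> f y) \<and>
    (\<forall>r\<in>carrier R. \<forall>x\<in>carrier M. f (r \<odot>\<^bsub>M\<^esub> x) = r \<odot>\<^bsub>N\<^esub> f x)}"

definition regular_module :: "('k, 'r) ring_scheme \<Rightarrow> ('k, 'k) module"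
  where "regular_module R =
    \<lparr>carrier = carrier R, monoid.mult = monoid.mult R, one = one R, zero = zero R, add = add R, smult = monoid.mult R\<rparr>"

definition span_submodule ::
    "('k, 'r) ring_scheme \<Rightarrow> ('k, 'a, 'm) module_scheme \<Rightarrow> 'a set \<Rightarrow> 'a set"
  where "span_submodule R M S = \<Inter> {N. submodule N R M \<and> S \<subseteq> N}"

text \<open>The record type of modules extends that of rings.  In the free modules and quotient modules
  below only the module structure is meant, and the ring multiplication and unit are left
  unspecified.\<close>

definition free_module :: "('k, 'r) ring_scheme \<Rightarrow> 'x set \<Rightarrow> ('k, 'x \<Rightarrow> 'k) module"
  where "free_module R X =
    \<lparr>carrier = {u. (\<forall>x\<in>X. u x \<in> carrier R) \<and> (\<forall>x. x \<notin> X \<longrightarrow> u x = \<zero>\<^bsub>R\<^esub>) \<and>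
                   finite {x. u x \<noteq> \<zero>\<^bsub>R\<^esub>}},
     monoid.mult = undefined, one = undefined,
     zero = (\<lambda>x. \<zero>\<^bsub>R\<^esub>),
     add = (\<lambda>u v x. u x \<oplus>\<^bsub>R\<^esub> v x),
     smult = (\<lambda>r u x. r \<otimes>\<^bsub>R\<^esub> u x)\<rparr>"

definition free_gen :: "('k, 'r) ring_scheme \<Rightarrow> 'x \<Rightarrow> 'x \<Rightarrow> 'k"
  where "free_gen R x = (\<lambda>y. if y = x then \<one>\<^bsub>R\<^esub> else \<zero>\<^bsub>R\<^esub>)"

definition quotient_module :: "('k, 'a, 'm) module_scheme \<Rightarrow> 'a set \<Rightarrow> ('k, 'a set) module"
  where "quotient_module M N =
    \<lparr>carrier = a_rcosets\<^bsub>M\<^esub> N,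
     monoid.mult = undefined, one = undefined,
     zero = N,
     add = (\<lambda>A B. A <+>\<^bsub>M\<^esub> B),
     smult = (\<lambda>r A. \<Union>x\<in>A. N +>\<^bsub>M\<^esub> (r \<odot>\<^bsub>M\<^esub> x))\<rparr>"


section \<open>Tensor powers\<close>

definition tuples :: "('k, 'h, 'm) module_scheme \<Rightarrow> nat \<Rightarrow> 'h list set"
  where "tuples H n = {xs. length xs = n \<and> set xs \<subseteq> carrier H}"

text \<open>The tensor power \<open>H\<^sup>\<otimes>\<^sup>n\<close> is the free module on the \<open>n\<close>-tuples of elements of \<open>H\<close>
  modulo the relations of multilinearity.  All tensor powers of \<open>H\<close> live in one type, the
  canonical isomorphisms \<open>H\<^sup>\<otimes>\<^sup>m \<otimes> H\<^sup>\<otimes>\<^sup>n \<cong> H\<^sup>\<otimes>\<^sup>(\<^sup>m\<^sup>+\<^sup>n\<^sup>)\<close> being given by concatenation of tuples; the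
  zeroth power is the free module on the empty tuple, that is, the base ring.\<close>

definition tensor_rels ::
    "('k, 'r) ring_scheme \<Rightarrow> ('k, 'h, 'm) module_scheme \<Rightarrow> nat \<Rightarrow> ('h list \<Rightarrow> 'k) set"
  where "tensor_rels R H n = (let F = free_module R (tuples H n) in
    {free_gen R (xs[i := a \<oplus>\<^bsub>H\<^esub> b]) \<ominus>\<^bsub>F\<^esub> (free_gen R (xs[i := a]) \<oplus>\<^bsub>F\<^esub> free_gen R (xs[i := b])) |
       xs i a b. xs \<in> tuples H n \<and> i < n \<and> a \<in> carrier H \<and> b \<in> carrier H} \<union>
    {free_gen R (xs[i := r \<odot>\<^bsub>H\<^esub> a]) \<ominus>\<^bsub>F\<^esub> (r \<odot>\<^bsub>F\<^esub> free_gen R (xs[i := a])) |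
       xs i r a. xs \<in> tuples H n \<and> i < n \<and> r \<in> carrier R \<and> a \<in> carrier H})"

definition tensor_null ::
    "('k, 'r) ring_scheme \<Rightarrow> ('k, 'h, 'm) module_scheme \<Rightarrow> nat \<Rightarrow> ('h list \<Rightarrow> 'k) set"
  where "tensor_null R H n = span_submodule R (free_module R (tuples H n)) (tensor_rels R H n)"

definition tensor_power ::
    "('k, 'r) ring_scheme \<Rightarrow> ('k, 'h, 'm) module_scheme \<Rightarrow> nat \<Rightarrow> ('k, ('h list \<Rightarrow> 'k) set) module"
  where "tensor_power R H n = quotient_module (free_module R (tuples H n)) (tensor_null R H n)"

definition pure_tensor ::
    "('k, 'r) ring_scheme \<Rightarrow> ('k, 'h, 'm) module_scheme \<Rightarrow> 'h list \<Rightarrow> ('h list \<Rightarrow> 'k) set"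
  where "pure_tensor R H xs = tensor_null R H (length xs)
    +>\<^bsub>free_module R (tuples H (length xs))\<^esub> free_gen R xs"

definition multilinear ::
    "('k, 'r) ring_scheme \<Rightarrow> ('k, 'h, 'm) module_scheme \<Rightarrow> nat \<Rightarrow> ('k, 'a, 'n) module_scheme
      \<Rightarrow> ('h list \<Rightarrow> 'a) \<Rightarrow> bool"
  where "multilinear R H n M \<phi> \<longleftrightarrow> \<phi> \<in> tuples H n \<rightarrow> carrier M \<and>
    (\<forall>xs\<in>tuples H n. \<forall>i<n. \<forall>a\<in>carrier H.
       (\<forall>b\<in>carrier H. \<phi> (xs[i := a \<oplus>\<^bsub>H\<^esub> b]) = \<phi> (xs[i := a]) \<oplus>\<^bsub>M\<^esub> \<phi> (xs[i := b])) \<and>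
       (\<forall>r\<in>carrier R. \<phi> (xs[i := r \<odot>\<^bsub>H\<^esub> a]) = r \<odot>\<^bsub>M\<^esub> \<phi> (xs[i := a])))"

text \<open>\<open>tensor_lift R H n M \<phi>\<close> is the linear map \<open>H\<^sup>\<otimes>\<^sup>n \<rightarrow> M\<close> that sends \<open>h\<^sub>1 \<otimes> \<dots> \<otimes> h\<^sub>n\<close> to
  \<open>\<phi> [h\<^sub>1, \<dots>, h\<^sub>n]\<close>.  For multilinear \<open>\<phi>\<close> it exists and is unique on the carrier: see
  \<open>tensor_lift_linear\<close>, \<open>tensor_lift_pure\<close> and \<open>tensor_linear_unique\<close> below.\<close>

definition tensor_lift ::
    "('k, 'r) ring_scheme \<Rightarrow> ('k, 'h, 'm) module_scheme \<Rightarrow> nat \<Rightarrow> ('k, 'a, 'n) module_scheme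
      \<Rightarrow> ('h list \<Rightarrow> 'a) \<Rightarrow> ('h list \<Rightarrow> 'k) set \<Rightarrow> 'a"
  where "tensor_lift R H n M \<phi> = (SOME f. f \<in> linear_maps R (tensor_power R H n) M \<and>
    (\<forall>xs\<in>tuples H n. f (pure_tensor R H xs) = \<phi> xs))"


subsection \<open>The universal property of the tensor powers\<close>

lemma linear_maps_closed: "\<lbrakk>f \<in> linear_maps R M N; x \<in> carrier M\<rbrakk> \<Longrightarrow> f x \<in> carrier N"
  and linear_maps_add: "\<lbrakk>f \<in> linear_maps R M N; x \<in> carrier M; y \<in> carrier M\<rbrakk>
    \<Longrightarrow> f (x \<oplus>\<^bsub>M\<^esub> y) = f x \<oplus>\<^bsub>N\<^esub> f y"
  and linear_maps_smult: "\<lbrakk>f \<in> linear_maps R M N; r \<in> carrier R; x \<in> carrier M\<rbrakk>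
    \<Longrightarrow> f (r \<odot>\<^bsub>M\<^esub> x) = r \<odot>\<^bsub>N\<^esub> f x"
  by (auto simp: linear_maps_def Pi_iff)

lemma linear_maps_kernel:
  assumes M: "module R M" and N: "module R N" and f: "f \<in> linear_maps R M N"
  shows "submodule {x \<in> carrier M. f x = \<zero>\<^bsub>N\<^esub>} R M"
proof -
  interpret M: module R M by fact
  interpret N: module R N by fact
  have z: "f \<zero>\<^bsub>M\<^esub> = \<zero>\<^bsub>N\<^esub>"
    using linear_maps_smult[OF f, of "\<zero>\<^bsub>R\<^esub>" "\<zero>\<^bsub>M\<^esub>"] linear_maps_closed[OF f, of "\<zero>\<^bsub>M\<^esub>"] by simp
  have neg: "\<ominus>\<^bsub>M\<^esub> x = (\<ominus>\<^bsub>R\<^esub> \<one>\<^bsub>R\<^esub>) \<odot>\<^bsub>M\<^esub> x" if "x \<in> carrier M" for x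
    using that M.smult_l_minus by simp
  show ?thesis
    by (rule M.submoduleI)
      (use z in \<open>auto simp: linear_maps_add[OF f] linear_maps_smult[OF f] neg\<close>)
qed

lemma span_submodule_is_submodule:
  assumes "module R M" "S \<subseteq> carrier M"
  shows "submodule (span_submodule R M S) R M"
proof -
  interpret M: module R M by fact
  have c: "submodule (carrier M) R M" by (rule M.carrier_is_submodule)
  show ?thesis
    unfolding span_submodule_def
    by (rule M.submoduleI) (use M.submoduleE c assms(2) in \<open>auto simp: Inter_iff subset_iff\<close>,
        auto dest: subgroup.one_closed[OF submodule.axioms(1)])
qed

lemma span_submodule_least: "\<lbrakk>submodule N R M; S \<subseteq> N\<rbrakk> \<Longrightarrow> span_submodule R M S \<subseteq> N"
  by (auto simp: span_submodule_def)

lemma span_submodule_superset: "S \<subseteq> span_submodule R M S"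
  by (auto simp: span_submodule_def)

lemma free_module_simps:
  "carrier (free_module R X) = {u. (\<forall>x\<in>X. u x \<in> carrier R) \<and> (\<forall>x. x \<notin> X \<longrightarrow> u x = \<zero>\<^bsub>R\<^esub>) \<and>
                   finite {x. u x \<noteq> \<zero>\<^bsub>R\<^esub>}}"
  "\<zero>\<^bsub>free_module R X\<^esub> = (\<lambda>x. \<zero>\<^bsub>R\<^esub>)"
  "u \<oplus>\<^bsub>free_module R X\<^esub> v = (\<lambda>x. u x \<oplus>\<^bsub>R\<^esub> v x)"
  "r \<odot>\<^bsub>free_module R X\<^esub> u = (\<lambda>x. r \<otimes>\<^bsub>R\<^esub> u x)"
  by (auto simp: free_module_def)

lemma free_module_is_module:
  assumes "cring R"
  shows "module R (free_module R X)"
proof -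
  interpret R: cring R by fact
  let ?F = "free_module R X"
  have cl: "u x \<in> carrier R" if "u \<in> carrier ?F" for u x
    using that by (cases "x \<in> X") (auto simp: free_module_simps)
  have add: "u \<oplus>\<^bsub>?F\<^esub> v \<in> carrier ?F" if "u \<in> carrier ?F" "v \<in> carrier ?F" for u v
  proof -
    have "finite ({x. u x \<noteq> \<zero>\<^bsub>R\<^esub>} \<union> {x. v x \<noteq> \<zero>\<^bsub>R\<^esub>})"
      using that by (simp add: free_module_simps)
    then have "finite {x. u x \<oplus>\<^bsub>R\<^esub> v x \<noteq> \<zero>\<^bsub>R\<^esub>}"
      by (rule rev_finite_subset) auto
    with that show ?thesis by (auto simp: free_module_simps)
  qed
  have smult: "r \<odot>\<^bsub>?F\<^esub> u \<in> carrier ?F" if "r \<in> carrier R" "u \<in> carrier ?F" for r u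
  proof -
    have "finite {x. u x \<noteq> \<zero>\<^bsub>R\<^esub>}"
      using that by (simp add: free_module_simps)
    then have "finite {x. r \<otimes>\<^bsub>R\<^esub> u x \<noteq> \<zero>\<^bsub>R\<^esub>}"
      by (rule rev_finite_subset) (use that in auto)
    with that show ?thesis by (auto simp: free_module_simps)
  qed
  have neg: "(\<ominus>\<^bsub>R\<^esub> \<one>\<^bsub>R\<^esub>) \<odot>\<^bsub>?F\<^esub> u \<oplus>\<^bsub>?F\<^esub> u = \<zero>\<^bsub>?F\<^esub>" if "u \<in> carrier ?F" for u
    using cl[OF that] by (simp add: free_module_simps R.l_minus R.l_neg)
  have ag: "abelian_group ?F"
  proof (rule abelian_groupI)
    fix u v w assume uvw: "u \<in> carrier ?F" "v \<in> carrier ?F" "w \<in> carrier ?F"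
    show "u \<oplus>\<^bsub>?F\<^esub> v \<oplus>\<^bsub>?F\<^esub> w = u \<oplus>\<^bsub>?F\<^esub> (v \<oplus>\<^bsub>?F\<^esub> w)"
      using cl[OF uvw(1)] cl[OF uvw(2)] cl[OF uvw(3)] by (simp add: free_module_simps R.a_assoc)
  next
    fix u v assume uv: "u \<in> carrier ?F" "v \<in> carrier ?F"
    show "u \<oplus>\<^bsub>?F\<^esub> v \<in> carrier ?F" using uv by (rule add)
    show "u \<oplus>\<^bsub>?F\<^esub> v = v \<oplus>\<^bsub>?F\<^esub> u"
      using cl[OF uv(1)] cl[OF uv(2)] by (simp add: free_module_simps R.a_comm)
  next
    fix u assume u: "u \<in> carrier ?F"
    show "\<zero>\<^bsub>?F\<^esub> \<oplus>\<^bsub>?F\<^esub> u = u"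
      using cl[OF u] by (simp add: free_module_simps)
    show "\<exists>y\<in>carrier ?F. y \<oplus>\<^bsub>?F\<^esub> u = \<zero>\<^bsub>?F\<^esub>"
      using neg[OF u] smult[OF _ u] by blast
  next
    show "\<zero>\<^bsub>?F\<^esub> \<in> carrier ?F" by (simp add: free_module_simps)
  qed
  show ?thesis
  proof (rule moduleI[OF assms ag smult])
    fix r s u assume rs: "r \<in> carrier R" "s \<in> carrier R" and u: "u \<in> carrier ?F"
    note c = cl[OF u]
    show "(r \<oplus>\<^bsub>R\<^esub> s) \<odot>\<^bsub>?F\<^esub> u = r \<odot>\<^bsub>?F\<^esub> u \<oplus>\<^bsub>?F\<^esub> s \<odot>\<^bsub>?F\<^esub> u"
      using rs c by (simp add: free_module_simps R.l_distr)
    show "r \<otimes>\<^bsub>R\<^esub> s \<odot>\<^bsub>?F\<^esub> u = r \<odot>\<^bsub>?F\<^esub> (s \<odot>\<^bsub>?F\<^esub> u)"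
      using rs c by (simp add: free_module_simps R.m_assoc)
  next
    fix r u v assume r: "r \<in> carrier R" and uv: "u \<in> carrier ?F" "v \<in> carrier ?F"
    show "r \<odot>\<^bsub>?F\<^esub> (u \<oplus>\<^bsub>?F\<^esub> v) = r \<odot>\<^bsub>?F\<^esub> u \<oplus>\<^bsub>?F\<^esub> r \<odot>\<^bsub>?F\<^esub> v"
      using r cl[OF uv(1)] cl[OF uv(2)] by (simp add: free_module_simps R.r_distr)
  next
    fix u assume u: "u \<in> carrier ?F"
    show "\<one>\<^bsub>R\<^esub> \<odot>\<^bsub>?F\<^esub> u = u"
      using cl[OF u] by (simp add: free_module_simps)
  qed
qed

lemma free_gen_closed:
  assumes "cring R" "x \<in> X"
  shows "free_gen R x \<in> carrier (free_module R X)"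
proof -
  interpret R: cring R by fact
  show ?thesis using assms(2)
    by (auto simp: free_module_simps free_gen_def)
qed

lemma free_module_induct [consumes 2, case_names gen zero add]:
  assumes R: "cring R" and u: "u \<in> carrier (free_module R X)"
    and gen: "\<And>r x. r \<in> carrier R \<Longrightarrow> x \<in> X \<Longrightarrow> P (r \<odot>\<^bsub>free_module R X\<^esub> free_gen R x)"
    and zero: "P \<zero>\<^bsub>free_module R X\<^esub>"
    and add: "\<And>u v. u \<in> carrier (free_module R X) \<Longrightarrow> v \<in> carrier (free_module R X) \<Longrightarrow>
      P u \<Longrightarrow> P v \<Longrightarrow> P (u \<oplus>\<^bsub>free_module R X\<^esub> v)"
  shows "P u"
proof -
  interpret R: cring R by fact
  let ?F = "free_module R X"
  interpret F: module R ?F by (rule free_module_is_module[OF R])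
  have "finite {x. u x \<noteq> \<zero>\<^bsub>R\<^esub>}" using u by (simp add: free_module_simps)
  moreover have "\<forall>u \<in> carrier ?F. {x. u x \<noteq> \<zero>\<^bsub>R\<^esub>} \<subseteq> A \<longrightarrow> P u" if "finite A" for A
    using that
  proof (induction A rule: finite_induct)
    case empty
    have "u = \<zero>\<^bsub>?F\<^esub>" if "{x. u x \<noteq> \<zero>\<^bsub>R\<^esub>} \<subseteq> {}" for u using that by (auto simp: free_module_simps)
    with zero show ?case by auto
  next
    case (insert a A)
    show ?case
    proof (intro ballI impI)
      fix u assume u: "u \<in> carrier ?F" and sub: "{x. u x \<noteq> \<zero>\<^bsub>R\<^esub>} \<subseteq> insert a A"
      have cl: "u x \<in> carrier R" for x
        using u by (cases "x \<in> X") (auto simp: free_module_simps)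
      show "P u"
      proof (cases "a \<in> X")
        case False
        then have "u a = \<zero>\<^bsub>R\<^esub>" using u by (simp add: free_module_simps)
        then show ?thesis using insert u sub by auto
      next
        case True
        define v where "v = u(a := \<zero>\<^bsub>R\<^esub>)"
        have "finite {x. u x \<noteq> \<zero>\<^bsub>R\<^esub>}" using u by (simp add: free_module_simps)
        then have "finite {x. v x \<noteq> \<zero>\<^bsub>R\<^esub>}" by (rule rev_finite_subset) (auto simp: v_def)
        then have v: "v \<in> carrier ?F"
          using u by (auto simp: free_module_simps v_def)
        have "{x. v x \<noteq> \<zero>\<^bsub>R\<^esub>} \<subseteq> A" using sub by (auto simp: v_def)
        with insert v have "P v" by blast
        moreover have "u = (u a \<odot>\<^bsub>?F\<^esub> free_gen R a) \<oplus>\<^bsub>?F\<^esub> v"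
          using cl by (auto simp: free_module_simps free_gen_def v_def fun_eq_iff)
        moreover have "u a \<odot>\<^bsub>?F\<^esub> free_gen R a \<in> carrier ?F"
          using cl free_gen_closed[OF R True] by (rule F.smult_closed)
        ultimately show ?thesis using add[OF _ v gen[OF cl True]] by metis
      qed
    qed
  qed
  ultimately show ?thesis using u by blast
qed

definition free_lift ::
    "('k, 'r) ring_scheme \<Rightarrow> ('k, 'a, 'm) module_scheme \<Rightarrow> ('x \<Rightarrow> 'a) \<Rightarrow> ('x \<Rightarrow> 'k) \<Rightarrow> 'a"
  where "free_lift R M \<phi> u = finsum M (\<lambda>x. u x \<odot>\<^bsub>M\<^esub> \<phi> x) {x. u x \<noteq> \<zero>\<^bsub>R\<^esub>}"

lemma free_lift:
  assumes M: "module R M" and \<phi>: "\<phi> \<in> X \<rightarrow> carrier M"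
  shows free_lift_linear: "free_lift R M \<phi> \<in> linear_maps R (free_module R X) M"
    and free_lift_gen: "x \<in> X \<Longrightarrow> free_lift R M \<phi> (free_gen R x) = \<phi> x"
proof -
  interpret M: module R M by fact
  let ?F = "free_module R X"
  interpret F: module R ?F by (rule free_module_is_module) unfold_locales
  have cl: "u x \<odot>\<^bsub>M\<^esub> \<phi> x \<in> carrier M" if "u \<in> carrier ?F" "x \<in> X" for u x
  proof (rule M.smult_closed)
    show "u x \<in> carrier R" using that by (simp add: free_module_simps)
    show "\<phi> x \<in> carrier M" using \<phi> that(2) by blast
  qed
  have supp: "finite {x. u x \<noteq> \<zero>\<^bsub>R\<^esub>}" "{x. u x \<noteq> \<zero>\<^bsub>R\<^esub>} \<subseteq> X" if "u \<in> carrier ?F" for u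
    using that by (auto simp: free_module_simps)
  have eq: "free_lift R M \<phi> u = finsum M (\<lambda>x. u x \<odot>\<^bsub>M\<^esub> \<phi> x) A"
    if u: "u \<in> carrier ?F" and A: "finite A" "{x. u x \<noteq> \<zero>\<^bsub>R\<^esub>} \<subseteq> A" "A \<subseteq> X" for u A
    unfolding free_lift_def
  proof (rule M.add.finprod_mono_neutral_cong_left)
    show "u x \<odot>\<^bsub>M\<^esub> \<phi> x = \<zero>\<^bsub>M\<^esub>" if "x \<in> A - {x. u x \<noteq> \<zero>\<^bsub>R\<^esub>}" for x
      using that A \<phi> by (auto simp: Pi_iff)
  qed (use A cl[OF u] in \<open>auto simp: Pi_iff\<close>)
  have clo: "free_lift R M \<phi> u \<in> carrier M" if "u \<in> carrier ?F" for u
    unfolding free_lift_def using cl[OF that] supp[OF that] by (intro M.finsum_closed) auto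
  show "free_lift R M \<phi> \<in> linear_maps R ?F M"
    unfolding linear_maps_def
  proof (intro CollectI conjI ballI funcsetI clo)
    fix u v assume uv: "u \<in> carrier ?F" "v \<in> carrier ?F"
    let ?A = "{x. u x \<noteq> \<zero>\<^bsub>R\<^esub>} \<union> {x. v x \<noteq> \<zero>\<^bsub>R\<^esub>}"
    have A: "finite ?A" "?A \<subseteq> X" using supp[OF uv(1)] supp[OF uv(2)] by auto
    have ca: "u x \<in> carrier R" "v x \<in> carrier R" "\<phi> x \<in> carrier M" if "x \<in> ?A" for x
      using that uv A(2) \<phi> by (auto simp: free_module_simps)
    have sub: "{x. (u \<oplus>\<^bsub>?F\<^esub> v) x \<noteq> \<zero>\<^bsub>R\<^esub>} \<subseteq> ?A" by (auto simp: free_module_simps)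
    have "free_lift R M \<phi> (u \<oplus>\<^bsub>?F\<^esub> v) = finsum M (\<lambda>x. (u \<oplus>\<^bsub>?F\<^esub> v) x \<odot>\<^bsub>M\<^esub> \<phi> x) ?A"
      using eq[OF F.a_closed[OF uv] A(1) sub A(2)] .
    also have "\<dots> = finsum M (\<lambda>x. u x \<odot>\<^bsub>M\<^esub> \<phi> x \<oplus>\<^bsub>M\<^esub> v x \<odot>\<^bsub>M\<^esub> \<phi> x) ?A"
    proof (rule M.finsum_cong')
      fix x assume "x \<in> ?A"
      from ca[OF this] show "(u \<oplus>\<^bsub>?F\<^esub> v) x \<odot>\<^bsub>M\<^esub> \<phi> x = u x \<odot>\<^bsub>M\<^esub> \<phi> x \<oplus>\<^bsub>M\<^esub> v x \<odot>\<^bsub>M\<^esub> \<phi> x"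
        by (simp add: free_module_simps M.smult_l_distr)
    qed (use ca in \<open>auto simp: Pi_iff\<close>)
    also have "\<dots> = finsum M (\<lambda>x. u x \<odot>\<^bsub>M\<^esub> \<phi> x) ?A \<oplus>\<^bsub>M\<^esub> finsum M (\<lambda>x. v x \<odot>\<^bsub>M\<^esub> \<phi> x) ?A"
      using ca by (intro M.finsum_addf) (auto simp: Pi_iff)
    also have "\<dots> = free_lift R M \<phi> u \<oplus>\<^bsub>M\<^esub> free_lift R M \<phi> v"
      using eq[OF uv(1) A(1) _ A(2)] eq[OF uv(2) A(1) _ A(2)] by simp
    finally show "free_lift R M \<phi> (u \<oplus>\<^bsub>?F\<^esub> v) = free_lift R M \<phi> u \<oplus>\<^bsub>M\<^esub> free_lift R M \<phi> v" .
  next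
    fix r u assume r: "r \<in> carrier R" and u: "u \<in> carrier ?F"
    let ?A = "{x. u x \<noteq> \<zero>\<^bsub>R\<^esub>}"
    have ca: "u x \<in> carrier R" "\<phi> x \<in> carrier M" if "x \<in> ?A" for x
      using that u supp(2)[OF u] \<phi> by (auto simp: free_module_simps)
    have sub: "{x. (r \<odot>\<^bsub>?F\<^esub> u) x \<noteq> \<zero>\<^bsub>R\<^esub>} \<subseteq> ?A" using r by (auto simp: free_module_simps)
    have "free_lift R M \<phi> (r \<odot>\<^bsub>?F\<^esub> u) = finsum M (\<lambda>x. (r \<odot>\<^bsub>?F\<^esub> u) x \<odot>\<^bsub>M\<^esub> \<phi> x) ?A"
      using eq[OF F.smult_closed[OF r u] supp(1)[OF u] sub supp(2)[OF u]] .
    also have "\<dots> = finsum M (\<lambda>x. r \<odot>\<^bsub>M\<^esub> (u x \<odot>\<^bsub>M\<^esub> \<phi> x)) ?A"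
    proof (rule M.finsum_cong')
      fix x assume "x \<in> ?A"
      from ca[OF this] show "(r \<odot>\<^bsub>?F\<^esub> u) x \<odot>\<^bsub>M\<^esub> \<phi> x = r \<odot>\<^bsub>M\<^esub> (u x \<odot>\<^bsub>M\<^esub> \<phi> x)"
        using r by (simp add: free_module_simps M.smult_assoc1)
    qed (use ca r in \<open>auto simp: Pi_iff\<close>)
    also have "\<dots> = r \<odot>\<^bsub>M\<^esub> free_lift R M \<phi> u"
      unfolding free_lift_def
      using ca r supp(1)[OF u] by (intro M.finsum_smult_ldistr[symmetric]) (auto simp: Pi_iff)
    finally show "free_lift R M \<phi> (r \<odot>\<^bsub>?F\<^esub> u) = r \<odot>\<^bsub>M\<^esub> free_lift R M \<phi> u" .
  qed
  assume x: "x \<in> X"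
  have "free_lift R M \<phi> (free_gen R x) = finsum M (\<lambda>y. free_gen R x y \<odot>\<^bsub>M\<^esub> \<phi> y) {x}"
    using x by (intro eq free_gen_closed) (auto simp: free_gen_def split: if_splits intro: M.R.is_cring)
  also have "\<dots> = \<phi> x"
  proof -
    have "\<phi> x \<in> carrier M" using x \<phi> by blast
    then show ?thesis by (simp add: free_gen_def)
  qed
  finally show "free_lift R M \<phi> (free_gen R x) = \<phi> x" .
qed

lemma quotient_module_simps:
  "carrier (quotient_module M N) = a_rcosets\<^bsub>M\<^esub> N"
  "\<zero>\<^bsub>quotient_module M N\<^esub> = N"
  "A \<oplus>\<^bsub>quotient_module M N\<^esub> B = A <+>\<^bsub>M\<^esub> B"
  "r \<odot>\<^bsub>quotient_module M N\<^esub> A = (\<Union>x\<in>A. N +>\<^bsub>M\<^esub> (r \<odot>\<^bsub>M\<^esub> x))"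
  by (auto simp: quotient_module_def)

lemma quotient_module:
  assumes M: "module R M" and N: "submodule N R M"
  shows quotient_module_is_module: "module R (quotient_module M N)"
    and quotient_proj_linear: "(\<lambda>x. N +>\<^bsub>M\<^esub> x) \<in> linear_maps R M (quotient_module M N)"
    and quotient_carrier: "carrier (quotient_module M N) = (\<lambda>x. N +>\<^bsub>M\<^esub> x) ` carrier M"
    and quotient_eq_iff: "\<lbrakk>x \<in> carrier M; y \<in> carrier M\<rbrakk> \<Longrightarrow> N +>\<^bsub>M\<^esub> x = N +>\<^bsub>M\<^esub> y \<longleftrightarrow> x \<ominus>\<^bsub>M\<^esub> y \<in> N"
proof -
  interpret M: module R M by fact
  interpret N: submodule N R M by fact
  interpret S: abelian_subgroup N M
    by (intro abelian_subgroupI3 additive_subgroup.intro N.subgroup_axioms M.abelian_group_axioms)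
  let ?Q = "quotient_module M N"
  show carr: "carrier ?Q = (\<lambda>x. N +>\<^bsub>M\<^esub> x) ` carrier M"
    by (auto simp: quotient_module_simps A_RCOSETS_def')
  show iff: "N +>\<^bsub>M\<^esub> x = N +>\<^bsub>M\<^esub> y \<longleftrightarrow> x \<ominus>\<^bsub>M\<^esub> y \<in> N" if "x \<in> carrier M" "y \<in> carrier M" for x y
    using that by (metis S.a_rcos_module S.a_rcos_self S.a_repr_independence' a_minus_def)
  have add: "(N +>\<^bsub>M\<^esub> x) \<oplus>\<^bsub>?Q\<^esub> (N +>\<^bsub>M\<^esub> y) = N +>\<^bsub>M\<^esub> (x \<oplus>\<^bsub>M\<^esub> y)"
    if "x \<in> carrier M" "y \<in> carrier M" for x y
    using that by (simp add: quotient_module_simps S.a_rcos_sum)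
  have smult: "r \<odot>\<^bsub>?Q\<^esub> (N +>\<^bsub>M\<^esub> x) = N +>\<^bsub>M\<^esub> (r \<odot>\<^bsub>M\<^esub> x)"
    if r: "r \<in> carrier R" and x: "x \<in> carrier M" for r x
  proof -
    have "N +>\<^bsub>M\<^esub> (r \<odot>\<^bsub>M\<^esub> y) = N +>\<^bsub>M\<^esub> (r \<odot>\<^bsub>M\<^esub> x)" if y: "y \<in> N +>\<^bsub>M\<^esub> x" for y
    proof -
      obtain n where n: "n \<in> N" "y = n \<oplus>\<^bsub>M\<^esub> x" using y by (auto simp: a_r_coset_def')
      have nM: "n \<in> carrier M" using n by auto
      have "r \<odot>\<^bsub>M\<^esub> y \<ominus>\<^bsub>M\<^esub> r \<odot>\<^bsub>M\<^esub> x = r \<odot>\<^bsub>M\<^esub> n"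
        using r x n nM by (simp add: M.smult_r_distr a_minus_def M.a_assoc M.r_neg)
      moreover have "r \<odot>\<^bsub>M\<^esub> n \<in> N" using r n by (intro N.smult_closed)
      ultimately show ?thesis using iff r x n nM by simp
    qed
    then have "r \<odot>\<^bsub>?Q\<^esub> (N +>\<^bsub>M\<^esub> x) = (\<Union>y\<in>N +>\<^bsub>M\<^esub> x. N +>\<^bsub>M\<^esub> (r \<odot>\<^bsub>M\<^esub> x))"
      unfolding quotient_module_simps by (rule SUP_cong[OF refl])
    also have "\<dots> = N +>\<^bsub>M\<^esub> (r \<odot>\<^bsub>M\<^esub> x)"
      using S.a_rcos_self[OF x] by blast
    finally show ?thesis .
  qed
  have zeroN: "\<zero>\<^bsub>M\<^esub> \<in> N" using N.one_closed by simp
  have z: "\<zero>\<^bsub>?Q\<^esub> = N +>\<^bsub>M\<^esub> \<zero>\<^bsub>M\<^esub>"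
    using M.add.coset_join2[OF M.zero_closed N.subgroup_axioms zeroN]
    by (simp add: quotient_module_simps a_r_coset_def)
  have ag: "abelian_group ?Q"
  proof (rule abelian_groupI)
    fix A assume "A \<in> carrier ?Q"
    then obtain x where x: "x \<in> carrier M" "A = N +>\<^bsub>M\<^esub> x" by (auto simp: carr)
    have "(N +>\<^bsub>M\<^esub> (\<ominus>\<^bsub>M\<^esub> x)) \<oplus>\<^bsub>?Q\<^esub> A = \<zero>\<^bsub>?Q\<^esub>"
      using x z add[of "\<ominus>\<^bsub>M\<^esub> x" x] by (simp add: M.l_neg)
    moreover have "N +>\<^bsub>M\<^esub> (\<ominus>\<^bsub>M\<^esub> x) \<in> carrier ?Q" using x by (simp add: carr)
    ultimately show "\<exists>B\<in>carrier ?Q. B \<oplus>\<^bsub>?Q\<^esub> A = \<zero>\<^bsub>?Q\<^esub>" by blast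
    show "\<zero>\<^bsub>?Q\<^esub> \<oplus>\<^bsub>?Q\<^esub> A = A" using x z by (simp add: add)
  next
    show "\<zero>\<^bsub>?Q\<^esub> \<in> carrier ?Q" unfolding z carr by blast
  qed (unfold carr, (elim imageE, simp add: add M.a_ac)+)
  show "module R ?Q"
    by (rule moduleI[OF M.R.is_cring ag], unfold carr)
      (elim imageE, simp add: add smult M.smult_l_distr M.smult_r_distr M.smult_assoc1)+
  show "(\<lambda>x. N +>\<^bsub>M\<^esub> x) \<in> linear_maps R M ?Q"
    by (auto simp: linear_maps_def carr add smult)
qed

lemma tuples_update: "\<lbrakk>xs \<in> tuples H n; a \<in> carrier H\<rbrakk> \<Longrightarrow> xs[i := a] \<in> tuples H n"
  using set_update_subset_insert[of xs i a] by (auto simp: tuples_def)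

lemma tensor_null_submodule:
  assumes "module R H"
  shows "submodule (tensor_null R H n) R (free_module R (tuples H n))"
proof -
  interpret H: module R H by fact
  interpret F: module R "free_module R (tuples H n)" by (rule free_module_is_module) unfold_locales
  have gen: "free_gen R (xs[i := a]) \<in> carrier (free_module R (tuples H n))"
    if "xs \<in> tuples H n" "a \<in> carrier H" for xs i a
    using that by (intro free_gen_closed H.R.is_cring tuples_update)
  have "tensor_rels R H n \<subseteq> carrier (free_module R (tuples H n))"
    unfolding tensor_rels_def Let_def
    using gen F.minus_closed F.a_closed F.smult_closed H.a_closed H.smult_closed by blast
  then show ?thesis
    unfolding tensor_null_def by (rule span_submodule_is_submodule[OF F.module_axioms])
qed

lemma tensor_power_is_module:
  assumes "module R H"
  shows "module R (tensor_power R H n)"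
proof -
  interpret H: module R H by fact
  show ?thesis
    unfolding tensor_power_def
    by (intro quotient_module_is_module free_module_is_module tensor_null_submodule) unfold_locales
qed

lemma pure_tensor_closed:
  assumes "module R H" "xs \<in> tuples H n"
  shows "pure_tensor R H xs \<in> carrier (tensor_power R H n)"
proof -
  interpret H: module R H by fact
  have n: "length xs = n" using assms(2) by (simp add: tuples_def)
  show ?thesis
    unfolding tensor_power_def pure_tensor_def n
    by (subst quotient_carrier)
      (auto intro!: free_module_is_module tensor_null_submodule free_gen_closed assms H.R.is_cring)
qed

lemma pure_tensor_multilinear:
  assumes H: "module R H"
  shows "multilinear R H n (tensor_power R H n) (pure_tensor R H)"
proof -
  interpret H: module R H by fact
  let ?F = "free_module R (tuples H n)" and ?N = "tensor_null R H n" and ?T = "tensor_power R H n"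
  have Fm: "module R ?F" by (rule free_module_is_module) unfold_locales
  interpret F: module R ?F by fact
  note N = tensor_null_submodule[OF H, of n]
  have lin: "(\<lambda>u. ?N +>\<^bsub>?F\<^esub> u) \<in> linear_maps R ?F ?T"
    unfolding tensor_power_def by (rule quotient_proj_linear[OF Fm N])
  have pure: "pure_tensor R H xs = ?N +>\<^bsub>?F\<^esub> free_gen R xs" if "xs \<in> tuples H n" for xs
    using that by (simp add: pure_tensor_def tuples_def)
  have rels: "tensor_rels R H n \<subseteq> ?N"
    unfolding tensor_null_def by (rule span_submodule_superset)
  have gen: "free_gen R xs \<in> carrier ?F" if "xs \<in> tuples H n" for xs
    using that by (intro free_gen_closed H.R.is_cring)
  show ?thesis
    unfolding multilinear_def
  proof (intro conjI ballI allI impI funcsetI pure_tensor_closed[OF H])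
    fix xs i a assume xs: "xs \<in> tuples H n" and i: "i < n" and a: "a \<in> carrier H"
    note up = tuples_update[OF xs]
    {
      fix b assume b: "b \<in> carrier H"
      have "free_gen R (xs[i := a \<oplus>\<^bsub>H\<^esub> b]) \<ominus>\<^bsub>?F\<^esub>
          (free_gen R (xs[i := a]) \<oplus>\<^bsub>?F\<^esub> free_gen R (xs[i := b])) \<in> tensor_rels R H n"
        unfolding tensor_rels_def Let_def using xs i a b by blast
      with rels have "?N +>\<^bsub>?F\<^esub> free_gen R (xs[i := a \<oplus>\<^bsub>H\<^esub> b]) =
          ?N +>\<^bsub>?F\<^esub> (free_gen R (xs[i := a]) \<oplus>\<^bsub>?F\<^esub> free_gen R (xs[i := b]))"
        using a b by (subst quotient_eq_iff[OF Fm N]) (auto intro!: gen up F.a_closed)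
      then show "pure_tensor R H (xs[i := a \<oplus>\<^bsub>H\<^esub> b]) =
          pure_tensor R H (xs[i := a]) \<oplus>\<^bsub>?T\<^esub> pure_tensor R H (xs[i := b])"
        using a b by (simp add: pure up linear_maps_add[OF lin] gen)
    next
      fix r assume r: "r \<in> carrier R"
      have "free_gen R (xs[i := r \<odot>\<^bsub>H\<^esub> a]) \<ominus>\<^bsub>?F\<^esub> (r \<odot>\<^bsub>?F\<^esub> free_gen R (xs[i := a]))
          \<in> tensor_rels R H n"
        unfolding tensor_rels_def Let_def using xs i a r by blast
      with rels have "?N +>\<^bsub>?F\<^esub> free_gen R (xs[i := r \<odot>\<^bsub>H\<^esub> a]) =
          ?N +>\<^bsub>?F\<^esub> (r \<odot>\<^bsub>?F\<^esub> free_gen R (xs[i := a]))"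
        using a r by (subst quotient_eq_iff[OF Fm N]) (auto intro!: gen up F.smult_closed)
      then show "pure_tensor R H (xs[i := r \<odot>\<^bsub>H\<^esub> a]) = r \<odot>\<^bsub>?T\<^esub> pure_tensor R H (xs[i := a])"
        using a r by (simp add: pure up linear_maps_smult[OF lin] gen)
    }
  qed
qed

lemma tensor_linear_unique:
  assumes H: "module R H" and M: "module R M"
    and f: "f \<in> linear_maps R (tensor_power R H n) M" and g: "g \<in> linear_maps R (tensor_power R H n) M"
    and eq: "\<And>xs. xs \<in> tuples H n \<Longrightarrow> f (pure_tensor R H xs) = g (pure_tensor R H xs)"
    and t: "t \<in> carrier (tensor_power R H n)"
  shows "f t = g t"
proof -
  interpret H: module R H by fact
  interpret M: module R M by fact
  let ?F = "free_module R (tuples H n)" and ?N = "tensor_null R H n" and ?T = "tensor_power R H n"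
  have Fm: "module R ?F" by (rule free_module_is_module) unfold_locales
  interpret F: module R ?F by fact
  note N = tensor_null_submodule[OF H, of n]
  let ?\<pi> = "\<lambda>u. ?N +>\<^bsub>?F\<^esub> u"
  have lin: "?\<pi> \<in> linear_maps R ?F ?T"
    unfolding tensor_power_def by (rule quotient_proj_linear[OF Fm N])
  have pure: "pure_tensor R H xs = ?\<pi> (free_gen R xs)" if "xs \<in> tuples H n" for xs
    using that by (simp add: pure_tensor_def tuples_def)
  have gen: "free_gen R xs \<in> carrier ?F" if "xs \<in> tuples H n" for xs
    using that by (intro free_gen_closed H.R.is_cring)
  obtain u where u: "u \<in> carrier ?F" "t = ?\<pi> u"
    using t quotient_carrier[OF Fm N] by (auto simp: tensor_power_def)
  have hom0: "h (?\<pi> \<zero>\<^bsub>?F\<^esub>) = \<zero>\<^bsub>M\<^esub>" if h: "h \<in> linear_maps R ?T M" for h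
  proof -
    have "?\<pi> (\<zero>\<^bsub>R\<^esub> \<odot>\<^bsub>?F\<^esub> \<zero>\<^bsub>?F\<^esub>) = \<zero>\<^bsub>R\<^esub> \<odot>\<^bsub>?T\<^esub> ?\<pi> \<zero>\<^bsub>?F\<^esub>"
      by (intro linear_maps_smult[OF lin]) auto
    then have "h (?\<pi> \<zero>\<^bsub>?F\<^esub>) = h (\<zero>\<^bsub>R\<^esub> \<odot>\<^bsub>?T\<^esub> ?\<pi> \<zero>\<^bsub>?F\<^esub>)" by simp
    also have "\<dots> = \<zero>\<^bsub>R\<^esub> \<odot>\<^bsub>M\<^esub> h (?\<pi> \<zero>\<^bsub>?F\<^esub>)"
      by (intro linear_maps_smult[OF h] linear_maps_closed[OF lin]) auto
    also have "\<dots> = \<zero>\<^bsub>M\<^esub>"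
      by (intro M.smult_l_null linear_maps_closed[OF h] linear_maps_closed[OF lin]) auto
    finally show ?thesis .
  qed
  have "f (?\<pi> u) = g (?\<pi> u)"
    using H.R.is_cring u(1)
  proof (induction u rule: free_module_induct)
    case (gen r xs)
    have "?\<pi> (r \<odot>\<^bsub>?F\<^esub> free_gen R xs) = r \<odot>\<^bsub>?T\<^esub> pure_tensor R H xs"
      using gen by (simp add: linear_maps_smult[OF lin] free_gen_closed H.R.is_cring pure)
    then show ?case
      using gen eq by (simp add: linear_maps_smult[OF f] linear_maps_smult[OF g] pure_tensor_closed[OF H])
  next
    case zero
    show ?case by (simp only: hom0[OF f] hom0[OF g])
  next
    case (add u v)
    then show ?case
      by (simp add: linear_maps_add[OF lin] linear_maps_add[OF f] linear_maps_add[OF g]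
          linear_maps_closed[OF lin])
  qed
  with u show ?thesis by simp
qed

lemma tensor_linear_exists:
  assumes H: "module R H" and M: "module R M" and \<phi>: "multilinear R H n M \<phi>"
  shows "\<exists>f. f \<in> linear_maps R (tensor_power R H n) M \<and>
    (\<forall>xs\<in>tuples H n. f (pure_tensor R H xs) = \<phi> xs)"
proof -
  interpret H: module R H by fact
  interpret M: module R M by fact
  let ?F = "free_module R (tuples H n)" and ?N = "tensor_null R H n" and ?T = "tensor_power R H n"
  have Fm: "module R ?F" by (rule free_module_is_module) unfold_locales
  interpret F: module R ?F by fact
  note N = tensor_null_submodule[OF H, of n]
  let ?\<pi> = "\<lambda>u. ?N +>\<^bsub>?F\<^esub> u"
  have lin: "?\<pi> \<in> linear_maps R ?F ?T"
    unfolding tensor_power_def by (rule quotient_proj_linear[OF Fm N])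
  have carr: "carrier ?T = ?\<pi> ` carrier ?F"
    unfolding tensor_power_def by (rule quotient_carrier[OF Fm N])
  have pure: "pure_tensor R H xs = ?\<pi> (free_gen R xs)" if "xs \<in> tuples H n" for xs
    using that by (simp add: pure_tensor_def tuples_def)
  have gen: "free_gen R xs \<in> carrier ?F" if "xs \<in> tuples H n" for xs
    using that by (intro free_gen_closed H.R.is_cring)
  have \<phi>c: "\<phi> \<in> tuples H n \<rightarrow> carrier M" using \<phi> by (simp add: multilinear_def)
  define L where "L = free_lift R M \<phi>"
  have L: "L \<in> linear_maps R ?F M" unfolding L_def by (rule free_lift_linear[OF M \<phi>c])
  have Lg: "L (free_gen R xs) = \<phi> xs" if "xs \<in> tuples H n" for xs
    unfolding L_def by (rule free_lift_gen[OF M \<phi>c that])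
  have Lminus: "L (u \<ominus>\<^bsub>?F\<^esub> v) = L u \<ominus>\<^bsub>M\<^esub> L v" if uv: "u \<in> carrier ?F" "v \<in> carrier ?F" for u v
  proof -
    have "L u = L ((u \<ominus>\<^bsub>?F\<^esub> v) \<oplus>\<^bsub>?F\<^esub> v)"
      using uv by (simp add: a_minus_def F.a_assoc F.l_neg)
    also have "\<dots> = L (u \<ominus>\<^bsub>?F\<^esub> v) \<oplus>\<^bsub>M\<^esub> L v"
      using uv by (intro linear_maps_add[OF L] F.minus_closed)
    finally show ?thesis
      using uv linear_maps_closed[OF L] F.minus_closed
      by (simp add: a_minus_def M.a_assoc M.r_neg)
  qed
  have self: "x \<ominus>\<^bsub>M\<^esub> x = \<zero>\<^bsub>M\<^esub>" if "x \<in> carrier M" for x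
    using that by (simp add: a_minus_def M.r_neg)
  have "tensor_rels R H n \<subseteq> {u \<in> carrier ?F. L u = \<zero>\<^bsub>M\<^esub>}"
  proof -
    have 1: "free_gen R (xs[i := a \<oplus>\<^bsub>H\<^esub> b]) \<ominus>\<^bsub>?F\<^esub>
          (free_gen R (xs[i := a]) \<oplus>\<^bsub>?F\<^esub> free_gen R (xs[i := b])) \<in> {u \<in> carrier ?F. L u = \<zero>\<^bsub>M\<^esub>}"
      if xs: "xs \<in> tuples H n" and i: "i < n" and ab: "a \<in> carrier H" "b \<in> carrier H" for xs i a b
    proof -
      note up = tuples_update[OF xs]
      have "\<phi> (xs[i := a \<oplus>\<^bsub>H\<^esub> b]) = \<phi> (xs[i := a]) \<oplus>\<^bsub>M\<^esub> \<phi> (xs[i := b])"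
        using \<phi> xs i ab by (auto simp: multilinear_def)
      moreover have "\<phi> (xs[i := a]) \<in> carrier M" "\<phi> (xs[i := b]) \<in> carrier M"
        using \<phi>c up ab by blast+
      ultimately show ?thesis
        using ab by (simp add: Lminus up gen linear_maps_add[OF L] Lg self)
    qed
    have 2: "free_gen R (xs[i := r \<odot>\<^bsub>H\<^esub> a]) \<ominus>\<^bsub>?F\<^esub> (r \<odot>\<^bsub>?F\<^esub> free_gen R (xs[i := a]))
        \<in> {u \<in> carrier ?F. L u = \<zero>\<^bsub>M\<^esub>}"
      if xs: "xs \<in> tuples H n" and i: "i < n" and ra: "r \<in> carrier R" "a \<in> carrier H" for xs i r a
    proof -
      note up = tuples_update[OF xs]
      have "\<phi> (xs[i := r \<odot>\<^bsub>H\<^esub> a]) = r \<odot>\<^bsub>M\<^esub> \<phi> (xs[i := a])"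
        using \<phi> xs i ra by (auto simp: multilinear_def)
      moreover have "\<phi> (xs[i := a]) \<in> carrier M"
        using \<phi>c up ra by blast
      ultimately show ?thesis
        using ra by (simp add: Lminus up gen linear_maps_smult[OF L] Lg self)
    qed
    show ?thesis unfolding tensor_rels_def Let_def using 1 2 by blast
  qed
  then have null: "?N \<subseteq> {u \<in> carrier ?F. L u = \<zero>\<^bsub>M\<^esub>}"
    unfolding tensor_null_def
    by (intro span_submodule_least linear_maps_kernel[OF Fm M L])
  have wd: "L u = L v" if uv: "u \<in> carrier ?F" "v \<in> carrier ?F" and "?\<pi> u = ?\<pi> v" for u v
  proof -
    have "L u \<ominus>\<^bsub>M\<^esub> L v = \<zero>\<^bsub>M\<^esub>"
      using that null quotient_eq_iff[OF Fm N uv] by (auto simp flip: Lminus)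
    moreover have "L u = (L u \<ominus>\<^bsub>M\<^esub> L v) \<oplus>\<^bsub>M\<^esub> L v"
      using linear_maps_closed[OF L] uv by (simp add: a_minus_def M.a_assoc M.l_neg)
    ultimately show ?thesis
      using linear_maps_closed[OF L] uv by simp
  qed
  define f where "f t = L (SOME u. u \<in> carrier ?F \<and> t = ?\<pi> u)" for t
  have f: "f (?\<pi> u) = L u" if u: "u \<in> carrier ?F" for u
  proof -
    define v where "v = (SOME v. v \<in> carrier ?F \<and> ?\<pi> u = ?\<pi> v)"
    have "v \<in> carrier ?F \<and> ?\<pi> u = ?\<pi> v"
      unfolding v_def by (rule someI[of "\<lambda>v. v \<in> carrier ?F \<and> ?\<pi> u = ?\<pi> v" u]) (simp only: u simp_thms)
    then have "L u = L v" by (intro wd u) simp_all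
    then show ?thesis unfolding f_def v_def by (rule sym)
  qed
  have "f \<in> linear_maps R ?T M"
    unfolding linear_maps_def
  proof (intro CollectI conjI ballI funcsetI)
    fix s assume "s \<in> carrier ?T"
    then obtain u where u: "u \<in> carrier ?F" "s = ?\<pi> u" unfolding carr by blast
    then show "f s \<in> carrier M" by (simp add: f linear_maps_closed[OF L])
    fix r assume r: "r \<in> carrier R"
    have "f (r \<odot>\<^bsub>?T\<^esub> s) = f (?\<pi> (r \<odot>\<^bsub>?F\<^esub> u))"
      using u r by (simp add: linear_maps_smult[OF lin])
    then show "f (r \<odot>\<^bsub>?T\<^esub> s) = r \<odot>\<^bsub>M\<^esub> f s"
      using u r by (simp add: f linear_maps_smult[OF L])
  next
    fix s t assume "s \<in> carrier ?T" "t \<in> carrier ?T"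
    then obtain u v where u: "u \<in> carrier ?F" "s = ?\<pi> u" and v: "v \<in> carrier ?F" "t = ?\<pi> v"
      unfolding carr by blast
    have "f (s \<oplus>\<^bsub>?T\<^esub> t) = f (?\<pi> (u \<oplus>\<^bsub>?F\<^esub> v))"
      using u v by (simp add: linear_maps_add[OF lin])
    then show "f (s \<oplus>\<^bsub>?T\<^esub> t) = f s \<oplus>\<^bsub>M\<^esub> f t"
      using u v by (simp add: f linear_maps_add[OF L])
  qed
  moreover have "f (pure_tensor R H xs) = \<phi> xs" if "xs \<in> tuples H n" for xs
    using that by (simp add: pure f gen Lg)
  ultimately show ?thesis by blast
qed

lemma tensor_lift:
  assumes "module R H" "module R M" "multilinear R H n M \<phi>"
  shows tensor_lift_linear: "tensor_lift R H n M \<phi> \<in> linear_maps R (tensor_power R H n) M"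
    and tensor_lift_pure: "xs \<in> tuples H n \<Longrightarrow> tensor_lift R H n M \<phi> (pure_tensor R H xs) = \<phi> xs"
  using someI_ex[OF tensor_linear_exists[OF assms]] unfolding tensor_lift_def by blast+


subsection \<open>Linear maps between tensor powers\<close>

text \<open>The canonical bilinear map \<open>H\<^sup>\<otimes>\<^sup>m \<times> H\<^sup>\<otimes>\<^sup>n \<rightarrow> H\<^sup>\<otimes>\<^sup>(\<^sup>m\<^sup>+\<^sup>n\<^sup>)\<close>.\<close>

definition tensor_append ::
    "('k, 'r) ring_scheme \<Rightarrow> ('k, 'h, 'm) module_scheme \<Rightarrow> nat \<Rightarrow> nat
      \<Rightarrow> ('h list \<Rightarrow> 'k) set \<Rightarrow> ('h list \<Rightarrow> 'k) set \<Rightarrow> ('h list \<Rightarrow> 'k) set"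
  where "tensor_append R H m n s t =
    tensor_lift R H m (tensor_power R H (m + n))
      (\<lambda>xs. tensor_lift R H n (tensor_power R H (m + n)) (\<lambda>ys. pure_tensor R H (xs @ ys)) t) s"

text \<open>The product \<open>(a\<^sub>1 \<otimes> \<dots> \<otimes> a\<^sub>n) (b\<^sub>1 \<otimes> \<dots> \<otimes> b\<^sub>n) = a\<^sub>1b\<^sub>1 \<otimes> \<dots> \<otimes> a\<^sub>nb\<^sub>n\<close> of the algebra \<open>H\<^sup>\<otimes>\<^sup>n\<close>.\<close>

definition tensor_mult ::
    "('k, 'r) ring_scheme \<Rightarrow> ('k, 'h, 'm) module_scheme \<Rightarrow> nat
      \<Rightarrow> ('h list \<Rightarrow> 'k) set \<Rightarrow> ('h list \<Rightarrow> 'k) set \<Rightarrow> ('h list \<Rightarrow> 'k) set"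
  where "tensor_mult R H n s t =
    tensor_lift R H n (tensor_power R H n)
      (\<lambda>xs. tensor_lift R H n (tensor_power R H n)
        (\<lambda>ys. pure_tensor R H (map2 (\<lambda>x y. x \<otimes>\<^bsub>H\<^esub> y) xs ys)) t) s"

text \<open>\<open>f\<^sub>1 \<otimes> \<dots> \<otimes> f\<^sub>n\<close> for linear maps \<open>f\<^sub>i : H \<rightarrow> H\<close>.\<close>

definition tensor_map ::
    "('k, 'r) ring_scheme \<Rightarrow> ('k, 'h, 'm) module_scheme \<Rightarrow> ('h \<Rightarrow> 'h) list
      \<Rightarrow> ('h list \<Rightarrow> 'k) set \<Rightarrow> ('h list \<Rightarrow> 'k) set"
  where "tensor_map R H fs = tensor_lift R H (length fs) (tensor_power R H (length fs))
    (\<lambda>xs. pure_tensor R H (map2 (\<lambda>f x. f x) fs xs))"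

text \<open>The left action of a permutation \<open>\<sigma>\<close> of \<open>{1..n}\<close>: the \<open>i\<close>-th factor of the image of
  \<open>h\<^sub>1 \<otimes> \<dots> \<otimes> h\<^sub>n\<close> is the factor of index \<open>\<sigma>\<^sup>-\<^sup>1(i)\<close>.  Positions in lists start at \<open>0\<close>.\<close>

definition tensor_permute ::
    "('k, 'r) ring_scheme \<Rightarrow> ('k, 'h, 'm) module_scheme \<Rightarrow> nat \<Rightarrow> (nat \<Rightarrow> nat)
      \<Rightarrow> ('h list \<Rightarrow> 'k) set \<Rightarrow> ('h list \<Rightarrow> 'k) set"
  where "tensor_permute R H n \<sigma> = tensor_lift R H n (tensor_power R H n)
    (\<lambda>xs. pure_tensor R H (map (\<lambda>i. xs ! (inv_into UNIV \<sigma> i - 1)) [1..<n + 1]))"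


section \<open>Graded bialgebras\<close>

text \<open>The locale \<open>algebra\<close> of the library is restricted to commutative algebras.\<close>

locale assoc_algebra = module R H + ring H for R (structure) and H (structure) +
  assumes smult_mult_left:
      "\<lbrakk>r \<in> carrier R; x \<in> carrier H; y \<in> carrier H\<rbrakk>
        \<Longrightarrow> (r \<odot>\<^bsub>H\<^esub> x) \<otimes>\<^bsub>H\<^esub> y = r \<odot>\<^bsub>H\<^esub> (x \<otimes>\<^bsub>H\<^esub> y)"
    and smult_mult_right:
      "\<lbrakk>r \<in> carrier R; x \<in> carrier H; y \<in> carrier H\<rbrakk>
        \<Longrightarrow> x \<otimes>\<^bsub>H\<^esub> (r \<odot>\<^bsub>H\<^esub> y) = r \<odot>\<^bsub>H\<^esub> (x \<otimes>\<^bsub>H\<^esub> y)"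

locale coalgebra = module R H for R (structure) and H (structure) +
  fixes \<Delta> :: "'c \<Rightarrow> ('c list \<Rightarrow> 'a) set" and \<epsilon> :: "'c \<Rightarrow> 'a"
  assumes comult_linear: "\<Delta> \<in> linear_maps R H (tensor_power R H 2)"
    and counit_linear: "\<epsilon> \<in> linear_maps R H (regular_module R)"
    and coassoc: "x \<in> carrier H \<Longrightarrow>
      tensor_lift R H 2 (tensor_power R H 3)
        (\<lambda>h. tensor_append R H 2 1 (\<Delta> (h ! 0)) (pure_tensor R H [h ! 1])) (\<Delta> x) =
      tensor_lift R H 2 (tensor_power R H 3)
        (\<lambda>h. tensor_append R H 1 2 (pure_tensor R H [h ! 0]) (\<Delta> (h ! 1))) (\<Delta> x)"
    and counit_left: "x \<in> carrier H \<Longrightarrow>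
      tensor_lift R H 2 H (\<lambda>h. \<epsilon> (h ! 0) \<odot>\<^bsub>H\<^esub> (h ! 1)) (\<Delta> x) = x"
    and counit_right: "x \<in> carrier H \<Longrightarrow>
      tensor_lift R H 2 H (\<lambda>h. \<epsilon> (h ! 1) \<odot>\<^bsub>H\<^esub> (h ! 0)) (\<Delta> x) = x"

locale bialgebra = assoc_algebra R H + coalgebra R H \<Delta> \<epsilon>
  for R (structure) and H (structure) and \<Delta> and \<epsilon> +
  assumes comult_mult: "\<lbrakk>x \<in> carrier H; y \<in> carrier H\<rbrakk>
      \<Longrightarrow> \<Delta> (x \<otimes>\<^bsub>H\<^esub> y) = tensor_mult R H 2 (\<Delta> x) (\<Delta> y)"
    and comult_one: "\<Delta> \<one>\<^bsub>H\<^esub> = pure_tensor R H [\<one>\<^bsub>H\<^esub>, \<one>\<^bsub>H\<^esub>]"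
    and counit_mult: "\<lbrakk>x \<in> carrier H; y \<in> carrier H\<rbrakk>
      \<Longrightarrow> \<epsilon> (x \<otimes>\<^bsub>H\<^esub> y) = \<epsilon> x \<otimes>\<^bsub>R\<^esub> \<epsilon> y"
    and counit_one: "\<epsilon> \<one>\<^bsub>H\<^esub> = \<one>\<^bsub>R\<^esub>"

definition is_graded_decomp ::
    "('k, 'h, 'm) module_scheme \<Rightarrow> (nat \<Rightarrow> 'h set) \<Rightarrow> 'h \<Rightarrow> (nat \<Rightarrow> 'h) \<Rightarrow> bool"
  where "is_graded_decomp H G x c \<longleftrightarrow> (\<forall>n. c n \<in> G n) \<and> finite {n. c n \<noteq> \<zero>\<^bsub>H\<^esub>} \<and>
    x = finsum H c {n. c n \<noteq> \<zero>\<^bsub>H\<^esub>}"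

text \<open>\<open>G n\<close> is the \<open>n\<close>-th graded component of \<open>H\<close>; that of \<open>H \<otimes> H\<close> is the sum of the images of
  the \<open>G i \<otimes> G j\<close> with \<open>i + j = n\<close>, and the base ring sits in degree \<open>0\<close>.\<close>

locale graded_bialgebra = bialgebra R H \<Delta> \<epsilon>
  for R (structure) and H (structure) and \<Delta> and \<epsilon> +
  fixes G :: "nat \<Rightarrow> 'c set"
  assumes grade_submodule: "submodule (G n) R H"
    and grade_direct_sum: "x \<in> carrier H \<Longrightarrow> \<exists>!c. is_graded_decomp H G x c"
    and grade_mult: "\<lbrakk>x \<in> G i; y \<in> G j\<rbrakk> \<Longrightarrow> x \<otimes>\<^bsub>H\<^esub> y \<in> G (i + j)"
    and grade_one: "\<one>\<^bsub>H\<^esub> \<in> G 0"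
    and grade_comult: "x \<in> G n \<Longrightarrow> \<Delta> x \<in> span_submodule R (tensor_power R H 2)
      {pure_tensor R H [a, b] | a b i j. a \<in> G i \<and> b \<in> G j \<and> i + j = n}"
    and grade_counit: "\<lbrakk>x \<in> G n; n > 0\<rbrakk> \<Longrightarrow> \<epsilon> x = \<zero>\<^bsub>R\<^esub>"

definition grade_proj :: "('k, 'h, 'm) module_scheme \<Rightarrow> (nat \<Rightarrow> 'h set) \<Rightarrow> nat \<Rightarrow> 'h \<Rightarrow> 'h"
  where "grade_proj H G n x = (THE c. is_graded_decomp H G x c) n"


section \<open>The operators \<open>p\<^sub>\<alpha>\<^sub>,\<^sub>\<sigma>\<close> and convolution\<close>

definition iter_mult ::
    "('k, 'r) ring_scheme \<Rightarrow> ('k, 'h, 'm) module_scheme \<Rightarrow> nat \<Rightarrow> ('h list \<Rightarrow> 'k) set \<Rightarrow> 'h"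
  where "iter_mult R H k = tensor_lift R H k H (\<lambda>h. foldr (\<lambda>x y. x \<otimes>\<^bsub>H\<^esub> y) h \<one>\<^bsub>H\<^esub>)"

text \<open>\<open>\<Delta>\<^sup>[\<^sup>0\<^sup>] = \<epsilon>\<close> and \<open>\<Delta>\<^sup>[\<^sup>k\<^sup>+\<^sup>1\<^sup>] = (\<Delta>\<^sup>[\<^sup>k\<^sup>] \<otimes> id) \<circ> \<Delta>\<close>; in particular \<open>\<Delta>\<^sup>[\<^sup>1\<^sup>] = id\<close> and \<open>\<Delta>\<^sup>[\<^sup>2\<^sup>] = \<Delta>\<close>.\<close>

primrec iter_comult ::
    "('k, 'r) ring_scheme \<Rightarrow> ('k, 'h, 'm) module_scheme \<Rightarrow> ('h \<Rightarrow> ('h list \<Rightarrow> 'k) set) \<Rightarrow> ('h \<Rightarrow> 'k)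
      \<Rightarrow> nat \<Rightarrow> 'h \<Rightarrow> ('h list \<Rightarrow> 'k) set"
  where
    "iter_comult R H \<Delta> \<epsilon> 0 = (\<lambda>x. \<epsilon> x \<odot>\<^bsub>tensor_power R H 0\<^esub> pure_tensor R H [])"
  | "iter_comult R H \<Delta> \<epsilon> (Suc k) = (\<lambda>x. tensor_lift R H 2 (tensor_power R H (k + 1))
      (\<lambda>h. tensor_append R H k 1 (iter_comult R H \<Delta> \<epsilon> k (h ! 0)) (pure_tensor R H [h ! 1])) (\<Delta> x))"

definition p_op ::
    "('k, 'r) ring_scheme \<Rightarrow> ('k, 'h, 'm) module_scheme \<Rightarrow> ('h \<Rightarrow> ('h list \<Rightarrow> 'k) set) \<Rightarrow> ('h \<Rightarrow> 'k)
      \<Rightarrow> (nat \<Rightarrow> 'h set) \<Rightarrow> nat list \<Rightarrow> (nat \<Rightarrow> nat) \<Rightarrow> 'h \<Rightarrow> 'h"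
  where "p_op R H \<Delta> \<epsilon> G \<alpha> \<sigma> =
    iter_mult R H (length \<alpha>)
      \<circ> tensor_map R H (map (grade_proj H G) \<alpha>)
      \<circ> tensor_permute R H (length \<alpha>) (inv_into UNIV \<sigma>)
      \<circ> iter_comult R H \<Delta> \<epsilon> (length \<alpha>)"

definition convolution ::
    "('k, 'r) ring_scheme \<Rightarrow> ('k, 'h, 'm) module_scheme \<Rightarrow> ('h \<Rightarrow> ('h list \<Rightarrow> 'k) set)
      \<Rightarrow> ('h \<Rightarrow> 'h) \<Rightarrow> ('h \<Rightarrow> 'h) \<Rightarrow> 'h \<Rightarrow> 'h"
  where "convolution R H \<Delta> f g =
    tensor_lift R H 2 H (\<lambda>h. h ! 0 \<otimes>\<^bsub>H\<^esub> h ! 1) \<circ> tensor_map R H [f, g] \<circ> \<Delta>"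

definition perm_oplus :: "nat \<Rightarrow> (nat \<Rightarrow> nat) \<Rightarrow> (nat \<Rightarrow> nat) \<Rightarrow> nat \<Rightarrow> nat"
  where "perm_oplus k \<sigma> \<tau> = (\<lambda>i. if i \<le> k then \<sigma> i else k + \<tau> (i - k))"

end

theory Submission
  imports Defs
begin

text \<open>Writing \<open>p\<^sub>\<alpha>\<^sub>,\<^sub>\<sigma> = M\<^sub>\<alpha>\<^sub>,\<^sub>\<sigma> \<circ> \<Delta>\<^sup>[\<^sup>k\<^sup>]\<close>, both factors are compatible with concatenation of tensors:
  \<open>M\<^sub>\<alpha>\<^sub>\<beta>\<^sub>,\<^sub>\<sigma>\<^sub>\<oplus>\<^sub>\<tau> (s \<otimes> t) = M\<^sub>\<alpha>\<^sub>,\<^sub>\<sigma> s \<cdot> M\<^sub>\<beta>\<^sub>,\<^sub>\<tau> t\<close>, and by coassociativity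
  \<open>\<Delta>\<^sup>[\<^sup>k\<^sup>+\<^sup>l\<^sup>] = (\<Delta>\<^sup>[\<^sup>k\<^sup>] \<otimes> \<Delta>\<^sup>[\<^sup>l\<^sup>]) \<circ> \<Delta>\<close>.  The convolution of \<open>p\<^sub>\<alpha>\<^sub>,\<^sub>\<sigma>\<close> and \<open>p\<^sub>\<beta>\<^sub>,\<^sub>\<tau>\<close> is therefore
  \<open>M\<^sub>\<alpha>\<^sub>\<beta>\<^sub>,\<^sub>\<sigma>\<^sub>\<oplus>\<^sub>\<tau> \<circ> (\<Delta>\<^sup>[\<^sup>k\<^sup>] \<otimes> \<Delta>\<^sup>[\<^sup>l\<^sup>]) \<circ> \<Delta>\<close>.\<close>

section \<open>Linear and bilinear maps between modules\<close>

text \<open>Curried form: fixing either argument yields an element of \<open>linear_maps\<close>,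
  the form in which \<open>tensor_linear_unique\<close> accepts its maps.\<close>

definition bilinear_maps ::
    "('k, 'r) ring_scheme \<Rightarrow> ('k, 'a, 'm) module_scheme \<Rightarrow> ('k, 'b, 'n) module_scheme
      \<Rightarrow> ('k, 'c, 'p) module_scheme \<Rightarrow> ('a \<Rightarrow> 'b \<Rightarrow> 'c) set"
  where "bilinear_maps R M N P = {\<phi>. (\<forall>x\<in>carrier M. \<phi> x \<in> linear_maps R N P) \<and>
    (\<forall>y\<in>carrier N. (\<lambda>x. \<phi> x y) \<in> linear_maps R M P)}"

lemma bilinear_maps_right: "\<phi> \<in> bilinear_maps R M N P \<Longrightarrow> x \<in> carrier M \<Longrightarrow> \<phi> x \<in> linear_maps R N P"
  and bilinear_maps_left:
    "\<phi> \<in> bilinear_maps R M N P \<Longrightarrow> y \<in> carrier N \<Longrightarrow> (\<lambda>x. \<phi> x y) \<in> linear_maps R M P"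
  by (auto simp: bilinear_maps_def)

lemma linear_maps_id: "(\<lambda>x. x) \<in> linear_maps R M M"
  by (simp add: linear_maps_def)

lemma linear_maps_compose:
  "g \<in> linear_maps R N P \<Longrightarrow> f \<in> linear_maps R M N \<Longrightarrow> (\<lambda>x. g (f x)) \<in> linear_maps R M P"
  by (auto simp: linear_maps_def Pi_iff)

lemma linear_maps_plus:
  assumes "module R N" "f \<in> linear_maps R M N" "g \<in> linear_maps R M N"
  shows "(\<lambda>x. f x \<oplus>\<^bsub>N\<^esub> g x) \<in> linear_maps R M N"
proof -
  interpret N: module R N by fact
  show ?thesis
    using assms(2,3) by (auto simp: linear_maps_def Pi_iff N.a_ac N.smult_r_distr)
qed

text \<open>Commutativity of \<open>R\<close> enters here: the factor \<open>r\<close> must be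
  exchanged with the scalar of the linearity condition.\<close>

lemma linear_maps_scale:
  assumes "module R N" "f \<in> linear_maps R M N" "r \<in> carrier R"
  shows "(\<lambda>x. r \<odot>\<^bsub>N\<^esub> f x) \<in> linear_maps R M N"
proof -
  interpret N: module R N by fact
  show ?thesis
    using assms(2,3)
    by (auto simp: linear_maps_def Pi_iff N.smult_r_distr N.R.m_comm simp flip: N.smult_assoc1)
qed

lemma bilinear_maps_compose:
  assumes "\<phi> \<in> bilinear_maps R M N P" "f \<in> linear_maps R M' M" "g \<in> linear_maps R N' N"
  shows "(\<lambda>x y. \<phi> (f x) (g y)) \<in> bilinear_maps R M' N' P"
  using assms unfolding bilinear_maps_def
  by (auto intro: linear_maps_compose[of "\<phi> (f _)"] linear_maps_compose[of "\<lambda>x. \<phi> x (g _)"]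
      dest: linear_maps_closed)

lemma linear_bilinear_compose:
  assumes "h \<in> linear_maps R P P'" "\<phi> \<in> bilinear_maps R M N P"
  shows "(\<lambda>x y. h (\<phi> x y)) \<in> bilinear_maps R M N P'"
  using assms unfolding bilinear_maps_def by (auto intro: linear_maps_compose)

section \<open>Tuples and multilinear maps\<close>

lemma tuples_append: "xs \<in> tuples H m \<Longrightarrow> ys \<in> tuples H n \<Longrightarrow> xs @ ys \<in> tuples H (m + n)"
  by (auto simp: tuples_def)

lemma tuples_2E:
  assumes "xs \<in> tuples H 2" obtains a b where "a \<in> carrier H" "b \<in> carrier H" "xs = [a, b]"
  using assms by (auto simp: tuples_def numeral_2_eq_2 length_Suc_conv)

lemma multilinearD:
  assumes "multilinear R H n M \<phi>" "xs \<in> tuples H n"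
  shows multilinear_closed: "\<phi> xs \<in> carrier M"
    and multilinear_add: "i < n \<Longrightarrow> a \<in> carrier H \<Longrightarrow> b \<in> carrier H \<Longrightarrow>
      \<phi> (xs[i := a \<oplus>\<^bsub>H\<^esub> b]) = \<phi> (xs[i := a]) \<oplus>\<^bsub>M\<^esub> \<phi> (xs[i := b])"
    and multilinear_smult: "i < n \<Longrightarrow> r \<in> carrier R \<Longrightarrow> a \<in> carrier H \<Longrightarrow>
      \<phi> (xs[i := r \<odot>\<^bsub>H\<^esub> a]) = r \<odot>\<^bsub>M\<^esub> \<phi> (xs[i := a])"
  using assms by (auto simp: multilinear_def)

lemma multilinear_linear:
  "multilinear R H n M \<phi> \<Longrightarrow> xs \<in> tuples H n \<Longrightarrow> i < n \<Longrightarrow> (\<lambda>a. \<phi> (xs[i := a])) \<in> linear_maps R H M"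
  by (auto simp: linear_maps_def multilinear_add multilinear_smult tuples_update
      intro: multilinear_closed)

text \<open>Converse to \<open>multilinear_linear\<close>: the slotwise equations become membership
  in \<open>linear_maps\<close>, so multilinearity can be proved by composing linear maps.\<close>

lemma multilinearI:
  assumes "\<And>xs. xs \<in> tuples H n \<Longrightarrow> \<phi> xs \<in> carrier M"
    and "\<And>xs i. xs \<in> tuples H n \<Longrightarrow> i < n \<Longrightarrow> (\<lambda>a. \<phi> (xs[i := a])) \<in> linear_maps R H M"
  shows "multilinear R H n M \<phi>"
  unfolding multilinear_def
  using assms by (auto dest: linear_maps_add linear_maps_smult)

text \<open>Changing slot \<open>i\<close> of the input changes only slot \<open>\<pi> i\<close> of
  \<open>L xs\<close>, by way of the linear map \<open>f i\<close>, so linearity is inherited slot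
  by slot. Appending a fixed tuple, applying maps factorwise and permuting factors are all of this
  kind.\<close>

lemma multilinear_reindex:
  assumes \<phi>: "multilinear R H n M \<phi>"
    and L: "\<And>xs. xs \<in> tuples H m \<Longrightarrow> L xs \<in> tuples H n"
    and upd: "\<And>xs i a. xs \<in> tuples H m \<Longrightarrow> i < m \<Longrightarrow> a \<in> carrier H \<Longrightarrow> L (xs[i := a]) = (L xs)[\<pi> i := f i a]"
    and \<pi>: "\<And>i. i < m \<Longrightarrow> \<pi> i < n" and f: "\<And>i. i < m \<Longrightarrow> f i \<in> linear_maps R H H"
    and H: "module R H"
  shows "multilinear R H m M (\<lambda>xs. \<phi> (L xs))"
proof (rule multilinearI)
  interpret H: module R H by fact
  fix xs assume xs: "xs \<in> tuples H m"
  then show "\<phi> (L xs) \<in> carrier M" by (intro multilinear_closed[OF \<phi>] L)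
  fix i assume i: "i < m"
  have "(\<lambda>a. \<phi> ((L xs)[\<pi> i := f i a])) \<in> linear_maps R H M"
    using linear_maps_compose[OF multilinear_linear[OF \<phi> L[OF xs] \<pi>[OF i]] f[OF i]] .
  then show "(\<lambda>a. \<phi> (L (xs[i := a]))) \<in> linear_maps R H M"
    using xs i by (simp add: linear_maps_def upd Pi_iff)
qed

lemma bilinear_multilinear:
  assumes "\<phi> \<in> bilinear_maps R H H M"
  shows "multilinear R H 2 M (\<lambda>h. \<phi> (h ! 0) (h ! 1))"
proof (rule multilinearI)
  fix xs assume xs: "xs \<in> tuples H 2"
  then obtain a b where ab: "a \<in> carrier H" "b \<in> carrier H" "xs = [a, b]" by (rule tuples_2E)
  then show "\<phi> (xs ! 0) (xs ! 1) \<in> carrier M"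
    using linear_maps_closed[OF bilinear_maps_right[OF assms]] by simp
  fix i :: nat assume "i < 2"
  then consider "i = 0" | "i = 1" by linarith
  then show "(\<lambda>c. \<phi> (xs[i := c] ! 0) (xs[i := c] ! 1)) \<in> linear_maps R H M"
    using ab bilinear_maps_right[OF assms] bilinear_maps_left[OF assms] by cases auto
qed

section \<open>Maps out of tensor powers\<close>

context
  fixes R :: "('k, 'r) ring_scheme" and H :: "('k, 'h, 'm) module_scheme"
  assumes H: "module R H"
begin

text \<open>The universal property for two factors in curried form, shaped to match the lifts in
  \<open>h ! 0\<close> and \<open>h ! 1\<close> that occur in \<open>convolution\<close> and in the
  coalgebra axioms.\<close>

lemma bilinear_lift:
  assumes "module R M" "\<phi> \<in> bilinear_maps R H H M"
  shows bilinear_lift_linear: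
      "tensor_lift R H 2 M (\<lambda>h. \<phi> (h ! 0) (h ! 1)) \<in> linear_maps R (tensor_power R H 2) M"
    and bilinear_lift_pure: "a \<in> carrier H \<Longrightarrow> b \<in> carrier H \<Longrightarrow>
      tensor_lift R H 2 M (\<lambda>h. \<phi> (h ! 0) (h ! 1)) (pure_tensor R H [a, b]) = \<phi> a b"
  using tensor_lift[OF H assms(1) bilinear_multilinear[OF assms(2)]]
  by (auto simp: tuples_def)

text \<open>\<open>tensor_linear_unique\<close> applied twice: in the second argument with a pure
  first argument, then in the first argument.\<close>

lemma tensor_bilinear_unique:
  assumes M: "module R M"
    and \<phi>: "\<phi> \<in> bilinear_maps R (tensor_power R H m) (tensor_power R H n) M"
    and \<psi>: "\<psi> \<in> bilinear_maps R (tensor_power R H m) (tensor_power R H n) M"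
    and eq: "\<And>xs ys. xs \<in> tuples H m \<Longrightarrow> ys \<in> tuples H n \<Longrightarrow>
      \<phi> (pure_tensor R H xs) (pure_tensor R H ys) = \<psi> (pure_tensor R H xs) (pure_tensor R H ys)"
    and s: "s \<in> carrier (tensor_power R H m)" and t: "t \<in> carrier (tensor_power R H n)"
  shows "\<phi> s t = \<psi> s t"
proof -
  have "\<phi> (pure_tensor R H xs) t = \<psi> (pure_tensor R H xs) t" if "xs \<in> tuples H m" for xs
    by (rule tensor_linear_unique[OF H M bilinear_maps_right[OF \<phi>] bilinear_maps_right[OF \<psi>] eq t])
      (use that pure_tensor_closed[OF H] in auto)
  then show ?thesis
    by (rule tensor_linear_unique[OF H M bilinear_maps_left[OF \<phi> t] bilinear_maps_left[OF \<psi> t] _ s])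
qed

text \<open>Linearity in \<open>s\<close> is built into the lift. Linearity in the parameter
  \<open>t\<close> holds because both sides of each equation are linear in \<open>s\<close> and
  agree on pure tensors.\<close>

lemma tensor_lift_bilinear:
  assumes P: "module R P"
    and mult: "\<And>t. t \<in> carrier N \<Longrightarrow> multilinear R H n P (\<lambda>xs. \<phi> xs t)"
    and lin: "\<And>xs. xs \<in> tuples H n \<Longrightarrow> \<phi> xs \<in> linear_maps R N P"
    and N: "module R N"
  shows "(\<lambda>s t. tensor_lift R H n P (\<lambda>xs. \<phi> xs t) s) \<in> bilinear_maps R (tensor_power R H n) N P"
proof -
  interpret N: module R N by fact
  note tl = tensor_lift_linear[OF H P mult] and tp = tensor_lift_pure[OF H P mult]
  have "(\<lambda>t. tensor_lift R H n P (\<lambda>xs. \<phi> xs t) s) \<in> linear_maps R N P"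
    if s: "s \<in> carrier (tensor_power R H n)" for s
    unfolding linear_maps_def
  proof (intro CollectI conjI ballI funcsetI)
    fix t assume t: "t \<in> carrier N"
    show "tensor_lift R H n P (\<lambda>xs. \<phi> xs t) s \<in> carrier P"
      by (rule linear_maps_closed[OF tl[OF t] s])
    {
      fix u assume u: "u \<in> carrier N"
      show "tensor_lift R H n P (\<lambda>xs. \<phi> xs (t \<oplus>\<^bsub>N\<^esub> u)) s =
          tensor_lift R H n P (\<lambda>xs. \<phi> xs t) s \<oplus>\<^bsub>P\<^esub> tensor_lift R H n P (\<lambda>xs. \<phi> xs u) s"
        by (rule tensor_linear_unique[OF H P tl linear_maps_plus[OF P tl tl] _ s])
          (use t u in \<open>simp_all add: tp linear_maps_add[OF lin]\<close>)
    }
    fix r assume r: "r \<in> carrier R"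
    show "tensor_lift R H n P (\<lambda>xs. \<phi> xs (r \<odot>\<^bsub>N\<^esub> t)) s = r \<odot>\<^bsub>P\<^esub> tensor_lift R H n P (\<lambda>xs. \<phi> xs t) s"
      by (rule tensor_linear_unique[OF H P tl linear_maps_scale[OF P tl] _ s])
        (use r t in \<open>simp_all add: tp linear_maps_smult[OF lin]\<close>)
  qed
  with tl show ?thesis by (auto simp: bilinear_maps_def)
qed

text \<open>Serves the inner lift in the nested definition of \<open>tensor_append\<close>: each
  equation in the parameter \<open>xs\<close> compares two linear maps of \<open>t\<close>, which
  agree on pure tensors.\<close>

lemma tensor_lift_multilinear:
  assumes P: "module R P"
    and left: "\<And>ys. ys \<in> tuples H n \<Longrightarrow> multilinear R H m P (\<lambda>xs. \<phi> xs ys)"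
    and right: "\<And>xs. xs \<in> tuples H m \<Longrightarrow> multilinear R H n P (\<phi> xs)"
    and t: "t \<in> carrier (tensor_power R H n)"
  shows "multilinear R H m P (\<lambda>xs. tensor_lift R H n P (\<phi> xs) t)"
proof -
  interpret H: module R H by (rule H)
  note tl = tensor_lift_linear[OF H P right] and tp = tensor_lift_pure[OF H P right]
  show ?thesis
    unfolding multilinear_def
  proof (intro conjI ballI allI impI funcsetI)
    fix xs assume xs: "xs \<in> tuples H m"
    show "tensor_lift R H n P (\<phi> xs) t \<in> carrier P" by (rule linear_maps_closed[OF tl[OF xs] t])
    fix i a assume i: "i < m" and a: "a \<in> carrier H"
    {
      fix b assume b: "b \<in> carrier H"
      show "tensor_lift R H n P (\<phi> (xs[i := a \<oplus>\<^bsub>H\<^esub> b])) t =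
          tensor_lift R H n P (\<phi> (xs[i := a])) t \<oplus>\<^bsub>P\<^esub> tensor_lift R H n P (\<phi> (xs[i := b])) t"
        by (rule tensor_linear_unique[OF H P tl linear_maps_plus[OF P tl tl] _ t])
          (use xs i a b in \<open>simp_all add: tp tuples_update multilinear_add[OF left]\<close>)
    }
    fix r assume r: "r \<in> carrier R"
    show "tensor_lift R H n P (\<phi> (xs[i := r \<odot>\<^bsub>H\<^esub> a])) t = r \<odot>\<^bsub>P\<^esub> tensor_lift R H n P (\<phi> (xs[i := a])) t"
      by (rule tensor_linear_unique[OF H P tl linear_maps_scale[OF P tl] _ t])
        (use xs i a r in \<open>simp_all add: tp tuples_update multilinear_smult[OF left]\<close>)
  qed
qed

section \<open>Concatenation of tensors\<close>

lemma pure_append_multilinear: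
  shows "ys \<in> tuples H n \<Longrightarrow> multilinear R H m (tensor_power R H (m + n)) (\<lambda>xs. pure_tensor R H (xs @ ys))"
    and "xs \<in> tuples H m \<Longrightarrow> multilinear R H n (tensor_power R H (m + n)) (\<lambda>ys. pure_tensor R H (xs @ ys))"
proof -
  show "multilinear R H m (tensor_power R H (m + n)) (\<lambda>xs. pure_tensor R H (xs @ ys))"
    if "ys \<in> tuples H n"
    using that
    by (intro multilinear_reindex[OF pure_tensor_multilinear[OF H], where f = "\<lambda>_ a. a" and \<pi> = "\<lambda>i. i"])
      (auto simp: linear_maps_id H tuples_def list_update_append)
  show "multilinear R H n (tensor_power R H (m + n)) (\<lambda>ys. pure_tensor R H (xs @ ys))"
    if "xs \<in> tuples H m"
    using that
    by (intro multilinear_reindex[OF pure_tensor_multilinear[OF H], where f = "\<lambda>_ a. a" and \<pi> = "\<lambda>i. m + i"])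
      (auto simp: linear_maps_id H tuples_def list_update_append)
qed

lemma tensor_append_bilinear:
  "tensor_append R H m n \<in> bilinear_maps R (tensor_power R H m) (tensor_power R H n) (tensor_power R H (m + n))"
  unfolding tensor_append_def[abs_def]
  by (intro tensor_lift_bilinear tensor_lift_multilinear tensor_lift_linear pure_append_multilinear
      tensor_power_is_module H)

lemma tensor_append_pure:
  assumes "xs \<in> tuples H m" "ys \<in> tuples H n"
  shows "tensor_append R H m n (pure_tensor R H xs) (pure_tensor R H ys) = pure_tensor R H (xs @ ys)"
proof -
  note T = tensor_power_is_module[OF H]
  have "multilinear R H m (tensor_power R H (m + n)) (\<lambda>xs. tensor_lift R H n (tensor_power R H (m + n))
      (\<lambda>ys. pure_tensor R H (xs @ ys)) (pure_tensor R H ys))"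
    by (intro tensor_lift_multilinear pure_append_multilinear T pure_tensor_closed[OF H] assms)
  then show ?thesis
    unfolding tensor_append_def
    using tensor_lift_pure[OF H T] pure_append_multilinear(2) assms by simp
qed

lemmas tensor_append_closed =
  linear_maps_closed[OF bilinear_maps_right[OF tensor_append_bilinear]]

text \<open>On pure tensors both sides are the concatenation of three lists, and linearity in each
  argument reduces the general case to this. The exponents \<open>m + n + p\<close> and
  \<open>m + (n + p)\<close> are equal numbers, so both sides lie in the same module and no
  isomorphism intervenes.\<close>

lemma tensor_append_assoc:
  assumes s: "s \<in> carrier (tensor_power R H m)" and t: "t \<in> carrier (tensor_power R H n)"
    and u: "u \<in> carrier (tensor_power R H p)"
  shows "tensor_append R H (m + n) p (tensor_append R H m n s t) u =
    tensor_append R H m (n + p) s (tensor_append R H n p t u)"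
proof (rule tensor_linear_unique[OF H tensor_power_is_module[OF H] _ _ _ s])
  note bil = tensor_append_bilinear and T = tensor_power_is_module[OF H]
  show "(\<lambda>s. tensor_append R H (m + n) p (tensor_append R H m n s t) u)
      \<in> linear_maps R (tensor_power R H m) (tensor_power R H (m + n + p))"
    using linear_maps_compose[OF bilinear_maps_left[OF bil u] bilinear_maps_left[OF bil t]] .
  show "(\<lambda>s. tensor_append R H m (n + p) s (tensor_append R H n p t u))
      \<in> linear_maps R (tensor_power R H m) (tensor_power R H (m + n + p))"
    using bilinear_maps_left[OF bil, of _ "n + p" m] t u
    by (simp add: tensor_append_closed add.assoc)
  fix xs assume xs: "xs \<in> tuples H m"
  let ?p = "pure_tensor R H xs"
  have p: "?p \<in> carrier (tensor_power R H m)" using xs by (rule pure_tensor_closed[OF H])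
  show "tensor_append R H (m + n) p (tensor_append R H m n ?p t) u =
    tensor_append R H m (n + p) ?p (tensor_append R H n p t u)"
  proof (rule tensor_bilinear_unique[OF T _ _ _ t u])
    show "(\<lambda>t u. tensor_append R H (m + n) p (tensor_append R H m n ?p t) u)
        \<in> bilinear_maps R (tensor_power R H n) (tensor_power R H p) (tensor_power R H (m + n + p))"
      by (rule bilinear_maps_compose[OF bil bilinear_maps_right[OF bil p] linear_maps_id])
    show "(\<lambda>t u. tensor_append R H m (n + p) ?p (tensor_append R H n p t u))
        \<in> bilinear_maps R (tensor_power R H n) (tensor_power R H p) (tensor_power R H (m + n + p))"
      using linear_bilinear_compose[OF bilinear_maps_right[OF bil p] bil] by (simp add: add.assoc)
  qed (use xs in \<open>simp add: tensor_append_pure tuples_append\<close>)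
qed

text \<open>The identification of \<open>H\<close> with its first tensor power, standing for the
  identity factor in \<open>iter_comult\<close> and \<open>coassoc\<close>.\<close>

lemma pure_singleton_linear: "(\<lambda>a. pure_tensor R H [a]) \<in> linear_maps R H (tensor_power R H 1)"
proof -
  interpret H: module R H by (rule H)
  show ?thesis
    \<comment> \<open>The entry of the one-element tuple is arbitrary, since it is
      overwritten.\<close>
    using multilinear_linear[OF pure_tensor_multilinear[OF H], where xs = "[\<zero>\<^bsub>H\<^esub>]" and i = 0]
    by (simp add: tuples_def)
qed

text \<open>\<open>pure_tensor R H []\<close> is neutral for concatenation because
  \<open>xs @ []\<close> is \<open>xs\<close>, and bilinearity extracts the scalar. This is how a
  counit value in the zeroth tensor power turns into a scalar factor.\<close>

lemma tensor_append_empty: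
  assumes r: "r \<in> carrier R" and s: "s \<in> carrier (tensor_power R H n)"
  shows "tensor_append R H n 0 s (r \<odot>\<^bsub>tensor_power R H 0\<^esub> pure_tensor R H []) =
    r \<odot>\<^bsub>tensor_power R H n\<^esub> s"
proof -
  note bil = tensor_append_bilinear and T = tensor_power_is_module[OF H]
  have e: "[] \<in> tuples H 0" by (simp add: tuples_def)
  note e' = pure_tensor_closed[OF H e]
  have "tensor_append R H n 0 s (pure_tensor R H []) = s"
    by (rule tensor_linear_unique[OF H T _ linear_maps_id _ s])
      (use bilinear_maps_left[OF bil e'] tensor_append_pure[OF _ e] in simp_all)
  then show ?thesis
    using linear_maps_smult[OF bilinear_maps_right[OF bil s] r e'] by simp
qed

section \<open>Factorwise maps and permutations of factors\<close>

lemma tensor_map: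
  assumes "set fs \<subseteq> linear_maps R H H"
  shows tensor_map_linear: "tensor_map R H fs \<in>
      linear_maps R (tensor_power R H (length fs)) (tensor_power R H (length fs))"
    and tensor_map_pure: "xs \<in> tuples H (length fs) \<Longrightarrow>
      tensor_map R H fs (pure_tensor R H xs) = pure_tensor R H (map2 (\<lambda>f x. f x) fs xs)"
proof -
  have lin: "fs ! i \<in> linear_maps R H H" if "i < length fs" for i
    using assms that by auto
  have cl: "(fs ! i) (xs ! i) \<in> carrier H"
    if "i < length fs" "length xs = length fs" "set xs \<subseteq> carrier H" for i xs
    using linear_maps_closed[OF lin] that by (metis nth_mem subsetD)
  have "multilinear R H (length fs) (tensor_power R H (length fs))
      (\<lambda>xs. pure_tensor R H (map2 (\<lambda>f x. f x) fs xs))"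
    by (intro multilinear_reindex[OF pure_tensor_multilinear[OF H], where f = "\<lambda>i. fs ! i" and \<pi> = "\<lambda>i. i"])
      (auto simp: H tuples_def nth_list_update set_zip cl lin intro!: nth_equalityI)
  note tensor_lift[OF H tensor_power_is_module[OF H] this]
  then show "tensor_map R H fs \<in>
      linear_maps R (tensor_power R H (length fs)) (tensor_power R H (length fs))"
    and "xs \<in> tuples H (length fs) \<Longrightarrow>
      tensor_map R H fs (pure_tensor R H xs) = pure_tensor R H (map2 (\<lambda>f x. f x) fs xs)"
    by (simp_all add: tensor_map_def)
qed

text \<open>Permutations act on \<open>{1..n}\<close> whereas list positions start at 0, hence the
  index \<open>\<sigma> i - 1\<close>; it is a valid position because \<open>\<sigma> i\<close>
  stays in \<open>{1..n}\<close>.\<close>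

lemma permuted_tuple:
  assumes \<sigma>: "\<sigma> permutes {1..n}" and xs: "xs \<in> tuples H n"
  shows "map (\<lambda>i. xs ! (\<sigma> i - 1)) [1..<n + 1] \<in> tuples H n"
proof -
  have "\<sigma> i - 1 < n" if "1 \<le> i" "i \<le> n" for i
    using permutes_in_image[OF \<sigma>, of i] that by auto
  with xs show ?thesis by (auto simp: tuples_def)
qed

text \<open>\<open>tensor_permute\<close> already inverts its permutation, so on the inverse of
  \<open>\<sigma>\<close> the two inversions cancel and factor \<open>i\<close> of the result is
  factor \<open>\<sigma> i\<close> of the input.\<close>

lemma tensor_permute_inv:
  assumes \<sigma>: "\<sigma> permutes {1..n}"
  shows tensor_permute_inv_linear:
      "tensor_permute R H n (inv_into UNIV \<sigma>) \<in> linear_maps R (tensor_power R H n) (tensor_power R H n)"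
    and tensor_permute_inv_pure: "xs \<in> tuples H n \<Longrightarrow>
      tensor_permute R H n (inv_into UNIV \<sigma>) (pure_tensor R H xs) =
      pure_tensor R H (map (\<lambda>i. xs ! (\<sigma> i - 1)) [1..<n + 1])"
proof -
  have inv: "inv_into UNIV (inv_into UNIV \<sigma>) = \<sigma>"
    by (rule inv_inv_eq[OF permutes_bij[OF \<sigma>]])
  \<comment> \<open>The position, counted from 0, at which slot \<open>i\<close> of the input
    arrives.\<close>
  let ?\<pi> = "\<lambda>i. inv_into UNIV \<sigma> (i + 1) - 1"
  have in_range: "1 \<le> \<sigma> i" "\<sigma> i \<le> n" if "1 \<le> i" "i \<le> n" for i
    using permutes_in_image[OF \<sigma>, of i] that by auto
  have inv_range: "1 \<le> inv_into UNIV \<sigma> (i + 1)" "inv_into UNIV \<sigma> (i + 1) \<le> n" if "i < n" for i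
    using permutes_in_image[OF permutes_inv[OF \<sigma>], of "i + 1"] that by auto
  have "multilinear R H n (tensor_power R H n)
      (\<lambda>xs. pure_tensor R H (map (\<lambda>i. xs ! (\<sigma> i - 1)) [1..<n + 1]))"
  proof (rule multilinear_reindex[OF pure_tensor_multilinear[OF H], where f = "\<lambda>_ a. a" and \<pi> = ?\<pi>])
    fix xs i a assume xs: "xs \<in> tuples H n" and i: "i < n"
    show "map (\<lambda>j. xs[i := a] ! (\<sigma> j - 1)) [1..<n + 1] =
        (map (\<lambda>j. xs ! (\<sigma> j - 1)) [1..<n + 1])[?\<pi> i := a]"
    proof (rule nth_equalityI)
      fix j assume "j < length (map (\<lambda>j. xs[i := a] ! (\<sigma> j - 1)) [1..<n + 1])"
      then have j: "j < n" by (simp del: upt_Suc)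
      \<comment> \<open>Both \<open>in_range\<close> and \<open>inv_range\<close> start at 1, so the
        truncated subtractions of 1 are reversible.\<close>
      have "\<sigma> (Suc j) - 1 = i \<longleftrightarrow> \<sigma> (Suc j) = i + 1"
        using in_range[of "Suc j"] j by auto
      also have "\<dots> \<longleftrightarrow> inv_into UNIV \<sigma> (i + 1) = Suc j"
        using permutes_inv_eq[OF \<sigma>, of "i + 1" "Suc j"] by auto
      also have "\<dots> \<longleftrightarrow> ?\<pi> i = j"
        using inv_range[OF i] by auto
      finally show "map (\<lambda>j. xs[i := a] ! (\<sigma> j - 1)) [1..<n + 1] ! j =
          (map (\<lambda>j. xs ! (\<sigma> j - 1)) [1..<n + 1])[?\<pi> i := a] ! j"
        using j i xs inv_range[OF i] by (auto simp: nth_list_update tuples_def simp del: upt_Suc)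
    qed simp
  next
    fix i assume "i < n"
    from inv_range[OF this] show "?\<pi> i < n" by auto
  qed (use permuted_tuple[OF \<sigma>] H in \<open>auto intro: linear_maps_id\<close>)
  note tensor_lift[OF H tensor_power_is_module[OF H] this]
  then show "tensor_permute R H n (inv_into UNIV \<sigma>) \<in> linear_maps R (tensor_power R H n) (tensor_power R H n)"
    and "xs \<in> tuples H n \<Longrightarrow> tensor_permute R H n (inv_into UNIV \<sigma>) (pure_tensor R H xs) =
      pure_tensor R H (map (\<lambda>i. xs ! (\<sigma> i - 1)) [1..<n + 1])"
    by (simp_all only: tensor_permute_def inv)
qed

end

section \<open>Iterated comultiplication\<close>

lemma scalar_linear:
  assumes "module R M" "v \<in> carrier M"
  shows "(\<lambda>r. r \<odot>\<^bsub>M\<^esub> v) \<in> linear_maps R (regular_module R) M"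
proof -
  interpret M: module R M by fact
  show ?thesis
    using assms(2) by (auto simp: linear_maps_def regular_module_def M.smult_l_distr M.smult_assoc1)
qed

context coalgebra
begin

lemma counit_scale_bilinear: "(\<lambda>a b. \<epsilon> b \<odot>\<^bsub>H\<^esub> a) \<in> bilinear_maps R H H H"
proof -
  have "\<epsilon> b \<in> carrier R" if "b \<in> carrier H" for b
    using linear_maps_closed[OF counit_linear that] by (simp add: regular_module_def)
  then show ?thesis
    unfolding bilinear_maps_def
    using linear_maps_compose[OF scalar_linear[OF module_axioms] counit_linear]
      linear_maps_scale[OF module_axioms linear_maps_id] by auto
qed

lemmas tensor_module = tensor_power_is_module[OF module_axioms]

text \<open>The map \<open>(f \<otimes> g) \<circ> \<Delta>\<close>.\<close>

definition comult_tensor ::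
    "nat \<Rightarrow> nat \<Rightarrow> ('c \<Rightarrow> ('c list \<Rightarrow> 'a) set) \<Rightarrow> ('c \<Rightarrow> ('c list \<Rightarrow> 'a) set) \<Rightarrow> 'c \<Rightarrow> ('c list \<Rightarrow> 'a) set"
  where "comult_tensor m n f g x = tensor_lift R H 2 (tensor_power R H (m + n))
    (\<lambda>h. tensor_append R H m n (f (h ! 0)) (g (h ! 1))) (\<Delta> x)"

lemma append_bilinear:
  assumes "f \<in> linear_maps R H (tensor_power R H m)" "g \<in> linear_maps R H (tensor_power R H n)"
  shows "(\<lambda>a b. tensor_append R H m n (f a) (g b)) \<in> bilinear_maps R H H (tensor_power R H (m + n))"
  using bilinear_maps_compose[OF tensor_append_bilinear[OF module_axioms] assms] .

lemma append_lift:
  assumes f: "f \<in> linear_maps R H (tensor_power R H m)" and g: "g \<in> linear_maps R H (tensor_power R H n)"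
  shows append_lift_linear: "tensor_lift R H 2 (tensor_power R H (m + n))
      (\<lambda>h. tensor_append R H m n (f (h ! 0)) (g (h ! 1)))
      \<in> linear_maps R (tensor_power R H 2) (tensor_power R H (m + n))"
    and append_lift_pure: "a \<in> carrier H \<Longrightarrow> b \<in> carrier H \<Longrightarrow>
      tensor_lift R H 2 (tensor_power R H (m + n))
        (\<lambda>h. tensor_append R H m n (f (h ! 0)) (g (h ! 1))) (pure_tensor R H [a, b]) =
      tensor_append R H m n (f a) (g b)"
  using bilinear_lift[OF module_axioms tensor_module append_bilinear[OF f g]] by auto

lemma comult_tensor_linear:
  assumes "f \<in> linear_maps R H (tensor_power R H m)" "g \<in> linear_maps R H (tensor_power R H n)"
  shows "comult_tensor m n f g \<in> linear_maps R H (tensor_power R H (m + n))"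
  unfolding comult_tensor_def[abs_def]
  by (rule linear_maps_compose[OF append_lift_linear[OF assms] comult_linear])

text \<open>The equation \<open>f a = f' a\<close> is assumed on \<open>carrier H\<close> only, so
  \<open>f\<close> cannot simply be rewritten; the two lifts agree on pure tensors and hence at
  \<open>\<Delta> x\<close>.\<close>

lemma comult_tensor_cong:
  assumes f: "f \<in> linear_maps R H (tensor_power R H m)" "f' \<in> linear_maps R H (tensor_power R H m)"
    and g: "g \<in> linear_maps R H (tensor_power R H n)"
    and eq: "\<And>a. a \<in> carrier H \<Longrightarrow> f a = f' a" and x: "x \<in> carrier H"
  shows "comult_tensor m n f g x = comult_tensor m n f' g x"
  unfolding comult_tensor_def
proof (rule tensor_linear_unique[OF module_axioms tensor_module
      append_lift_linear[OF f(1) g] append_lift_linear[OF f(2) g] _ linear_maps_closed[OF comult_linear x]])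
  fix xs assume "xs \<in> tuples H 2"
  then show "tensor_lift R H 2 (tensor_power R H (m + n))
        (\<lambda>h. tensor_append R H m n (f (h ! 0)) (g (h ! 1))) (pure_tensor R H xs) =
      tensor_lift R H 2 (tensor_power R H (m + n))
        (\<lambda>h. tensor_append R H m n (f' (h ! 0)) (g (h ! 1))) (pure_tensor R H xs)"
    by (elim tuples_2E) (simp add: append_lift_pure f g eq del: One_nat_def)
qed

text \<open>Both sides arise by applying one linear map, the tensor product of \<open>f\<close>,
  \<open>g\<close> and \<open>h\<close>, to the two sides of \<open>coassoc\<close>.\<close>

lemma comult_tensor_assoc:
  assumes f: "f \<in> linear_maps R H (tensor_power R H m)"
    and g: "g \<in> linear_maps R H (tensor_power R H n)"
    and h: "h \<in> linear_maps R H (tensor_power R H p)"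
    and x: "x \<in> carrier H"
  shows "comult_tensor (m + n) p (comult_tensor m n f g) h x =
    comult_tensor m (n + p) f (comult_tensor n p g h) x"
proof -
  note H = module_axioms
  note app = tensor_append_bilinear[OF H] and app_pure = tensor_append_pure[OF H]
  note cl = linear_maps_closed[OF f] linear_maps_closed[OF g] linear_maps_closed[OF h]
    tensor_append_closed[OF H]
  note \<iota> = pure_singleton_linear[OF H]
  let ?S = "tensor_power R H (m + n + p)"
  \<comment> \<open>The three factors are bracketed to the left; the comparison \<open>right\<close>
    below therefore needs \<open>tensor_append_assoc\<close>.\<close>
  define \<phi> where "\<phi> xs = tensor_append R H (m + n) p
    (tensor_append R H m n (f (xs ! 0)) (g (xs ! 1))) (h (xs ! 2))" for xs
  have \<phi>: "multilinear R H 3 ?S \<phi>"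
  proof (rule multilinearI)
    fix xs assume "xs \<in> tuples H 3"
    then obtain a b c where abc: "a \<in> carrier H" "b \<in> carrier H" "c \<in> carrier H" "xs = [a, b, c]"
      by (auto simp: tuples_def numeral_3_eq_3 length_Suc_conv)
    then show "\<phi> xs \<in> carrier ?S" by (simp add: \<phi>_def cl)
    fix i :: nat assume "i < 3"
    then consider "i = 0" | "i = 1" | "i = 2" by linarith
    then show "(\<lambda>d. \<phi> (xs[i := d])) \<in> linear_maps R H ?S"
    proof cases
      case 1
      then show ?thesis
        using abc by (auto simp: \<phi>_def cl intro!: linear_maps_compose[OF bilinear_maps_left[OF app]]
            bilinear_maps_left[OF append_bilinear[OF f g]])
    next
      case 2
      then show ?thesis
        using abc by (auto simp: \<phi>_def cl intro!: linear_maps_compose[OF bilinear_maps_left[OF app]]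
            bilinear_maps_right[OF append_bilinear[OF f g]])
    next
      case 3
      then show ?thesis
        using abc by (auto simp: \<phi>_def cl intro!: linear_maps_compose[OF bilinear_maps_right[OF app] h])
    qed
  qed
  define \<Phi> where "\<Phi> = tensor_lift R H 3 ?S \<phi>"
  have \<Phi>: "\<Phi> \<in> linear_maps R (tensor_power R H 3) ?S"
    unfolding \<Phi>_def by (rule tensor_lift_linear[OF H tensor_module \<phi>])
  have \<Phi>_pure: "\<Phi> (pure_tensor R H [a, b, c]) =
      tensor_append R H (m + n) p (tensor_append R H m n (f a) (g b)) (h c)"
    if "a \<in> carrier H" "b \<in> carrier H" "c \<in> carrier H" for a b c
    using tensor_lift_pure[OF H tensor_module \<phi>, of "[a, b, c]"] that
    by (simp add: \<Phi>_def \<phi>_def tuples_def)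
  \<comment> \<open>The tensor \<open>\<Delta> a\<close> is generalised to an arbitrary
    \<open>t\<close>: both sides are linear in \<open>t\<close> and agree on pure tensors.\<close>
  have left: "tensor_append R H (m + n) p (comult_tensor m n f g a) (h b) =
      \<Phi> (tensor_append R H 2 1 (\<Delta> a) (pure_tensor R H [b]))"
    if a: "a \<in> carrier H" and b: "b \<in> carrier H" for a b
    unfolding comult_tensor_def
  proof (rule tensor_linear_unique[OF H tensor_module _ _ _ linear_maps_closed[OF comult_linear a]])
    show "(\<lambda>t. tensor_append R H (m + n) p (tensor_lift R H 2 (tensor_power R H (m + n))
        (\<lambda>h. tensor_append R H m n (f (h ! 0)) (g (h ! 1))) t) (h b)) \<in> linear_maps R (tensor_power R H 2) ?S"
      by (intro linear_maps_compose[OF bilinear_maps_left[OF app]] append_lift_linear f g cl b)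
    show "(\<lambda>t. \<Phi> (tensor_append R H 2 1 t (pure_tensor R H [b]))) \<in> linear_maps R (tensor_power R H 2) ?S"
      using linear_maps_compose[OF _ bilinear_maps_left[OF app linear_maps_closed[OF \<iota> b]], of \<Phi> 2 ?S] \<Phi>
      by simp
    fix xs assume "xs \<in> tuples H 2"
    then show "tensor_append R H (m + n) p (tensor_lift R H 2 (tensor_power R H (m + n))
        (\<lambda>h. tensor_append R H m n (f (h ! 0)) (g (h ! 1))) (pure_tensor R H xs)) (h b) =
      \<Phi> (tensor_append R H 2 1 (pure_tensor R H xs) (pure_tensor R H [b]))"
      using b by (elim tuples_2E) (simp add: append_lift_pure f g app_pure tuples_def \<Phi>_pure del: One_nat_def)
  qed
  have right: "tensor_append R H m (n + p) (f a) (comult_tensor n p g h b) =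
      \<Phi> (tensor_append R H 1 2 (pure_tensor R H [a]) (\<Delta> b))"
    if a: "a \<in> carrier H" and b: "b \<in> carrier H" for a b
    unfolding comult_tensor_def
  proof (rule tensor_linear_unique[OF H tensor_module _ _ _ linear_maps_closed[OF comult_linear b]])
    show "(\<lambda>t. tensor_append R H m (n + p) (f a) (tensor_lift R H 2 (tensor_power R H (n + p))
        (\<lambda>k. tensor_append R H n p (g (k ! 0)) (h (k ! 1))) t)) \<in> linear_maps R (tensor_power R H 2) ?S"
      unfolding add.assoc
      by (intro linear_maps_compose[OF bilinear_maps_right[OF app]] append_lift_linear g h cl a)
    show "(\<lambda>t. \<Phi> (tensor_append R H 1 2 (pure_tensor R H [a]) t)) \<in> linear_maps R (tensor_power R H 2) ?S"
      using linear_maps_compose[OF _ bilinear_maps_right[OF app linear_maps_closed[OF \<iota> a]], of \<Phi> 2 ?S] \<Phi>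
      by (simp del: One_nat_def)
    fix xs assume "xs \<in> tuples H 2"
    then show "tensor_append R H m (n + p) (f a) (tensor_lift R H 2 (tensor_power R H (n + p))
        (\<lambda>k. tensor_append R H n p (g (k ! 0)) (h (k ! 1))) (pure_tensor R H xs)) =
      \<Phi> (tensor_append R H 1 2 (pure_tensor R H [a]) (pure_tensor R H xs))"
      using a by (elim tuples_2E)
        (simp add: append_lift_pure g h app_pure tuples_def \<Phi>_pure cl tensor_append_assoc[OF H] del: One_nat_def)
  qed
  note \<Delta>x = linear_maps_closed[OF comult_linear x]
  have "comult_tensor (m + n) p (comult_tensor m n f g) h x =
      \<Phi> (tensor_lift R H 2 (tensor_power R H 3)
        (\<lambda>h. tensor_append R H 2 1 (\<Delta> (h ! 0)) (pure_tensor R H [h ! 1])) (\<Delta> x))"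
    unfolding comult_tensor_def[of "m + n" p]
  proof (rule tensor_linear_unique[OF H tensor_module
        append_lift_linear[OF comult_tensor_linear[OF f g] h] linear_maps_compose[OF \<Phi>] _ \<Delta>x])
    show "tensor_lift R H 2 (tensor_power R H 3)
        (\<lambda>h. tensor_append R H 2 1 (\<Delta> (h ! 0)) (pure_tensor R H [h ! 1]))
        \<in> linear_maps R (tensor_power R H 2) (tensor_power R H 3)"
      \<comment> \<open>The map \<Delta> \<otimes> id is the instance of
        \<open>append_lift_linear\<close> with exponents 2 and 1.\<close>
      using append_lift_linear[OF comult_linear \<iota>] by simp
  qed (use append_lift_pure[OF comult_linear \<iota>] in
      \<open>auto elim!: tuples_2E simp: append_lift_pure comult_tensor_linear f g h left simp del: One_nat_def\<close>)
  also have "\<dots> = \<Phi> (tensor_lift R H 2 (tensor_power R H 3)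
        (\<lambda>h. tensor_append R H 1 2 (pure_tensor R H [h ! 0]) (\<Delta> (h ! 1))) (\<Delta> x))"
    using coassoc[OF x] by simp
  also have "\<dots> = comult_tensor m (n + p) f (comult_tensor n p g h) x"
    unfolding comult_tensor_def[of m "n + p"]
  proof (rule tensor_linear_unique[OF H tensor_module
        linear_maps_compose[OF \<Phi>[unfolded add.assoc]] append_lift_linear[OF f comult_tensor_linear[OF g h]] _ \<Delta>x])
    show "tensor_lift R H 2 (tensor_power R H 3)
        (\<lambda>h. tensor_append R H 1 2 (pure_tensor R H [h ! 0]) (\<Delta> (h ! 1)))
        \<in> linear_maps R (tensor_power R H 2) (tensor_power R H 3)"
      using append_lift_linear[OF \<iota> comult_linear] by (simp del: One_nat_def)
  qed (use append_lift_pure[OF \<iota> comult_linear] in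
      \<open>auto elim!: tuples_2E simp: append_lift_pure comult_tensor_linear f g h right simp del: One_nat_def\<close>)
  finally show ?thesis .
qed

lemma iter_comult_Suc:
  "iter_comult R H \<Delta> \<epsilon> (Suc k) = comult_tensor k 1 (iter_comult R H \<Delta> \<epsilon> k) (\<lambda>a. pure_tensor R H [a])"
  by (simp add: comult_tensor_def fun_eq_iff)

lemma iter_comult_linear: "iter_comult R H \<Delta> \<epsilon> k \<in> linear_maps R H (tensor_power R H k)"
proof (induction k)
  case 0
  have "pure_tensor R H [] \<in> carrier (tensor_power R H 0)"
    by (rule pure_tensor_closed[OF module_axioms]) (simp add: tuples_def)
  then show ?case
    using linear_maps_compose[OF scalar_linear[OF tensor_module] counit_linear] by simp
next
  case (Suc k)
  then show ?case
    using comult_tensor_linear[OF Suc pure_singleton_linear[OF module_axioms]]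
    by (simp only: iter_comult_Suc) simp
qed

text \<open>\<open>tensor_append_empty\<close> turns the last factor into the scalar
  \<open>\<epsilon> b\<close>, linearity moves this scalar inside \<open>iter_comult\<close>, and
  what remains is \<open>counit_right\<close>.\<close>

lemma comult_tensor_counit:
  assumes x: "x \<in> carrier H"
  shows "comult_tensor k 0 (iter_comult R H \<Delta> \<epsilon> k) (iter_comult R H \<Delta> \<epsilon> 0) x = iter_comult R H \<Delta> \<epsilon> k x"
proof -
  let ?D = "iter_comult R H \<Delta> \<epsilon>"
  note H = module_axioms
  note lift = bilinear_lift[OF H H counit_scale_bilinear]
  have "comult_tensor k 0 (?D k) (?D 0) x = ?D k (tensor_lift R H 2 H (\<lambda>h. \<epsilon> (h ! 1) \<odot>\<^bsub>H\<^esub> (h ! 0)) (\<Delta> x))"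
    unfolding comult_tensor_def
  proof (rule tensor_linear_unique[OF H tensor_module append_lift_linear _ _
        linear_maps_closed[OF comult_linear x]])
    show "(\<lambda>t. ?D k (tensor_lift R H 2 H (\<lambda>h. \<epsilon> (h ! 1) \<odot>\<^bsub>H\<^esub> (h ! 0)) t))
        \<in> linear_maps R (tensor_power R H 2) (tensor_power R H (k + 0))"
      using linear_maps_compose[OF iter_comult_linear lift(1)] by simp
    fix xs assume "xs \<in> tuples H 2"
    then obtain a b where ab: "a \<in> carrier H" "b \<in> carrier H" "xs = [a, b]" by (rule tuples_2E)
    have \<epsilon>: "\<epsilon> b \<in> carrier R"
      using linear_maps_closed[OF counit_linear ab(2)] by (simp add: regular_module_def)
    have "tensor_append R H k 0 (?D k a) (?D 0 b) = ?D k (\<epsilon> b \<odot>\<^bsub>H\<^esub> a)"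
      using linear_maps_closed[OF iter_comult_linear ab(1)]
      by (simp add: tensor_append_empty[OF H \<epsilon>] linear_maps_smult[OF iter_comult_linear \<epsilon> ab(1)])
    then show "tensor_lift R H 2 (tensor_power R H (k + 0))
        (\<lambda>h. tensor_append R H k 0 (?D k (h ! 0)) (?D 0 (h ! 1))) (pure_tensor R H xs) =
      ?D k (tensor_lift R H 2 H (\<lambda>h. \<epsilon> (h ! 1) \<odot>\<^bsub>H\<^esub> (h ! 0)) (pure_tensor R H xs))"
      unfolding ab(3) append_lift_pure[OF iter_comult_linear iter_comult_linear ab(1,2)]
        lift(2)[OF ab(1,2)] .
  qed (rule iter_comult_linear)+
  then show ?thesis by (simp only: counit_right[OF x])
qed

text \<open>Induction on \<open>l\<close>, with the counit axiom as base. In the step the recursion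
  splits off the last factor, the hypothesis splits the rest, and coassociativity attaches the last
  factor to the second block, where the recursion absorbs it.\<close>

lemma iter_comult_add:
  "x \<in> carrier H \<Longrightarrow> iter_comult R H \<Delta> \<epsilon> (k + l) x =
    comult_tensor k l (iter_comult R H \<Delta> \<epsilon> k) (iter_comult R H \<Delta> \<epsilon> l) x"
proof (induction l arbitrary: x)
  case 0
  then show ?case by (simp only: comult_tensor_counit add_0_right)
next
  case (Suc l)
  let ?D = "iter_comult R H \<Delta> \<epsilon>"
  note lin = iter_comult_linear pure_singleton_linear[OF module_axioms]
  have "?D (k + Suc l) x = comult_tensor (k + l) 1 (?D (k + l)) (\<lambda>a. pure_tensor R H [a]) x"
    by (simp only: add_Suc_right iter_comult_Suc)
  also have "\<dots> = comult_tensor (k + l) 1 (comult_tensor k l (?D k) (?D l)) (\<lambda>a. pure_tensor R H [a]) x"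
    by (rule comult_tensor_cong) (use Suc in \<open>simp_all only: lin comult_tensor_linear\<close>)
  also have "\<dots> = comult_tensor k (l + 1) (?D k) (comult_tensor l 1 (?D l) (\<lambda>a. pure_tensor R H [a])) x"
    by (rule comult_tensor_assoc) (use Suc.prems in \<open>simp_all only: lin\<close>)
  finally show ?case by (simp only: iter_comult_Suc Suc_eq_plus1[symmetric])
qed

end

section \<open>Iterated multiplication\<close>

context assoc_algebra
begin

lemma mult_bilinear: "(\<lambda>a b. a \<otimes>\<^bsub>H\<^esub> b) \<in> bilinear_maps R H H H"
  by (auto simp: bilinear_maps_def linear_maps_def smult_mult_left smult_mult_right l_distr r_distr)

lemma foldr_mult_closed: "set xs \<subseteq> carrier H \<Longrightarrow> foldr (\<lambda>x y. x \<otimes>\<^bsub>H\<^esub> y) xs \<one>\<^bsub>H\<^esub> \<in> carrier H"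
  by (induction xs) auto

lemma foldr_mult_append:
  "set xs \<subseteq> carrier H \<Longrightarrow> set ys \<subseteq> carrier H \<Longrightarrow>
    foldr (\<lambda>x y. x \<otimes>\<^bsub>H\<^esub> y) (xs @ ys) \<one>\<^bsub>H\<^esub> =
    foldr (\<lambda>x y. x \<otimes>\<^bsub>H\<^esub> y) xs \<one>\<^bsub>H\<^esub> \<otimes>\<^bsub>H\<^esub> foldr (\<lambda>x y. x \<otimes>\<^bsub>H\<^esub> y) ys \<one>\<^bsub>H\<^esub>"
proof (induction xs)
  case (Cons x xs)
  then show ?case
    using foldr_mult_closed[of xs] foldr_mult_closed[of ys] by (simp add: m_assoc)
qed (use foldr_mult_closed[of ys] in simp)

lemma foldr_mult_multilinear: "multilinear R H n H (\<lambda>h. foldr (\<lambda>x y. x \<otimes>\<^bsub>H\<^esub> y) h \<one>\<^bsub>H\<^esub>)"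
proof (rule multilinearI)
  let ?p = "\<lambda>h. foldr (\<lambda>x y. x \<otimes>\<^bsub>H\<^esub> y) h \<one>\<^bsub>H\<^esub>"
  fix xs assume xs: "xs \<in> tuples H n"
  then show "?p xs \<in> carrier H" by (intro foldr_mult_closed) (simp add: tuples_def)
  fix i assume i: "i < n"
  have sub: "set (take i xs) \<subseteq> carrier H" "set (drop (Suc i) xs) \<subseteq> carrier H"
    using xs set_take_subset[of i xs] set_drop_subset[of "Suc i" xs] by (auto simp: tuples_def)
  \<comment> \<open>Splitting the list at \<open>i\<close> isolates the variable entry between two
    fixed products; bilinearity of the multiplication then gives linearity in
    \<open>a\<close>.\<close>
  have "?p (xs[i := a]) = ?p (take i xs) \<otimes>\<^bsub>H\<^esub> (a \<otimes>\<^bsub>H\<^esub> ?p (drop (Suc i) xs))" if "a \<in> carrier H" for a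
    using xs i that sub foldr_mult_append[OF sub(1), of "a # drop (Suc i) xs"]
    by (simp add: upd_conv_take_nth_drop tuples_def del: foldr_append)
  moreover have "(\<lambda>a. ?p (take i xs) \<otimes>\<^bsub>H\<^esub> (a \<otimes>\<^bsub>H\<^esub> ?p (drop (Suc i) xs))) \<in> linear_maps R H H"
    using linear_maps_compose[OF bilinear_maps_right[OF mult_bilinear] bilinear_maps_left[OF mult_bilinear]]
      foldr_mult_closed sub by blast
  ultimately show "(\<lambda>a. ?p (xs[i := a])) \<in> linear_maps R H H"
    by (simp add: linear_maps_def Pi_iff)
qed

lemma iter_mult:
  shows iter_mult_linear: "iter_mult R H k \<in> linear_maps R (tensor_power R H k) H"
    and iter_mult_pure: "xs \<in> tuples H k \<Longrightarrow>
      iter_mult R H k (pure_tensor R H xs) = foldr (\<lambda>x y. x \<otimes>\<^bsub>H\<^esub> y) xs \<one>\<^bsub>H\<^esub>"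
  using tensor_lift[OF module_axioms module_axioms foldr_mult_multilinear]
  by (simp_all add: iter_mult_def)

end


section \<open>Linearity of the graded projections\<close>

lemma (in graded_bialgebra) grade_proj_decomp:
  "x \<in> carrier H \<Longrightarrow> is_graded_decomp H G x (\<lambda>n. grade_proj H G n x)"
  unfolding grade_proj_def using theI'[OF grade_direct_sum] by simp

text \<open>Uniqueness of the graded decomposition. The index set \<open>A\<close> may exceed the
  support of \<open>c\<close>, as the extra summands are zero; this lets several decompositions be
  summed over one common set.\<close>

lemma (in graded_bialgebra) grade_proj_eqI:
  assumes c: "\<And>n. c n \<in> G n" and A: "finite A" "\<And>n. n \<notin> A \<Longrightarrow> c n = \<zero>\<^bsub>H\<^esub>"
  shows "grade_proj H G n (finsum H c A) = c n"
proof -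
  have cH: "c n \<in> carrier H" for n
    using c submoduleE(1)[OF grade_submodule] by blast
  have "finsum H c {n. c n \<noteq> \<zero>\<^bsub>H\<^esub>} = finsum H c A"
    by (rule add.finprod_mono_neutral_cong_left) (use A cH in auto)
  moreover have "finite {n. c n \<noteq> \<zero>\<^bsub>H\<^esub>}"
    by (rule finite_subset[OF _ A(1)]) (use A(2) in auto)
  ultimately have dec: "is_graded_decomp H G (finsum H c A) c"
    using c by (simp add: is_graded_decomp_def)
  have "finsum H c A \<in> carrier H" using cH by auto
  then have "(THE d. is_graded_decomp H G (finsum H c A) d) = c"
    by (rule the1_equality[OF grade_direct_sum, OF _ dec])
  then show ?thesis by (simp add: grade_proj_def)
qed

lemma (in graded_bialgebra) grade_proj_finsum:
  assumes x: "x \<in> carrier H" and A: "finite A" "{n. grade_proj H G n x \<noteq> \<zero>\<^bsub>H\<^esub>} \<subseteq> A"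
  shows "finsum H (\<lambda>n. grade_proj H G n x) A = x"
proof -
  note dec = grade_proj_decomp[OF x, unfolded is_graded_decomp_def]
  have cH: "grade_proj H G n x \<in> carrier H" for n
    using dec submoduleE(1)[OF grade_submodule] by blast
  have "finsum H (\<lambda>n. grade_proj H G n x) {n. grade_proj H G n x \<noteq> \<zero>\<^bsub>H\<^esub>} =
      finsum H (\<lambda>n. grade_proj H G n x) A"
    by (rule add.finprod_mono_neutral_cong_left) (use A cH in auto)
  with dec show ?thesis by simp
qed

text \<open>Adding or scaling components gives a decomposition of the sum or the multiple, and
  uniqueness identifies its components.\<close>

lemma (in graded_bialgebra) grade_proj_linear: "grade_proj H G n \<in> linear_maps R H H"
proof -
  let ?p = "grade_proj H G"
  let ?S = "\<lambda>x. {n. ?p n x \<noteq> \<zero>\<^bsub>H\<^esub>}"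
  have G: "?p n x \<in> G n" and fin: "finite (?S x)" if "x \<in> carrier H" for n x
    using grade_proj_decomp[OF that] by (auto simp: is_graded_decomp_def)
  have cH: "?p n x \<in> carrier H" if "x \<in> carrier H" for n x
    using G[OF that] submoduleE(1)[OF grade_submodule] by blast
  show ?thesis
    unfolding linear_maps_def
  proof (intro CollectI conjI ballI funcsetI cH)
    fix x y assume x: "x \<in> carrier H" and y: "y \<in> carrier H"
    \<comment> \<open>A common index set; cancellation may make the support of the sum smaller,
      which \<open>grade_proj_eqI\<close> allows.\<close>
    let ?A = "?S x \<union> ?S y"
    have A: "finite ?A" using fin x y by simp
    have "finsum H (\<lambda>n. ?p n x \<oplus>\<^bsub>H\<^esub> ?p n y) ?A = finsum H (\<lambda>n. ?p n x) ?A \<oplus>\<^bsub>H\<^esub> finsum H (\<lambda>n. ?p n y) ?A"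
      using x y cH by (intro finsum_addf) auto
    also have "\<dots> = x \<oplus>\<^bsub>H\<^esub> y"
      using grade_proj_finsum[OF x A] grade_proj_finsum[OF y A] by auto
    finally have "finsum H (\<lambda>n. ?p n x \<oplus>\<^bsub>H\<^esub> ?p n y) ?A = x \<oplus>\<^bsub>H\<^esub> y" .
    moreover have "?p n (finsum H (\<lambda>n. ?p n x \<oplus>\<^bsub>H\<^esub> ?p n y) ?A) = ?p n x \<oplus>\<^bsub>H\<^esub> ?p n y"
      by (rule grade_proj_eqI[OF _ A]) (use x y G submoduleE(5)[OF grade_submodule] in auto)
    ultimately show "?p n (x \<oplus>\<^bsub>H\<^esub> y) = ?p n x \<oplus>\<^bsub>H\<^esub> ?p n y" by simp
  next
    fix r x assume r: "r \<in> carrier R" and x: "x \<in> carrier H"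
    have "finsum H (\<lambda>n. r \<odot>\<^bsub>H\<^esub> ?p n x) (?S x) = r \<odot>\<^bsub>H\<^esub> finsum H (\<lambda>n. ?p n x) (?S x)"
      using r x cH fin by (intro finsum_smult_ldistr[symmetric]) auto
    also have "\<dots> = r \<odot>\<^bsub>H\<^esub> x"
      by (simp add: grade_proj_finsum[OF x fin[OF x]])
    finally have "finsum H (\<lambda>n. r \<odot>\<^bsub>H\<^esub> ?p n x) (?S x) = r \<odot>\<^bsub>H\<^esub> x" .
    moreover have "?p n (finsum H (\<lambda>n. r \<odot>\<^bsub>H\<^esub> ?p n x) (?S x)) = r \<odot>\<^bsub>H\<^esub> ?p n x"
      by (rule grade_proj_eqI[OF _ fin[OF x]]) (use r x G submoduleE(4)[OF grade_submodule] in auto)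
    ultimately show "?p n (r \<odot>\<^bsub>H\<^esub> x) = r \<odot>\<^bsub>H\<^esub> ?p n x" by simp
  qed
qed

section \<open>Block sums of permutations\<close>

text \<open>Bijectivity comes from an explicit two-sided inverse, the block sum of the
  inverses.\<close>

lemma perm_oplus_permutes:
  assumes "\<sigma> permutes {1..k}" "\<tau> permutes {1..l}"
  shows "perm_oplus k \<sigma> \<tau> permutes {1..k + l}"
proof -
  \<comment> \<open>\<open>le\<close> and \<open>pos\<close> keep the two branches of
    \<open>perm_oplus\<close> apart: the first maps to indices up to \<open>k\<close>, the second to
    indices beyond \<open>k\<close>. The index 0 falls into the first branch and is fixed
    there.\<close>
  have le: "\<pi> i \<le> k" if "\<pi> permutes {1..k}" "i \<le> k" for \<pi> i
    using permutes_in_image[OF that(1), of i] permutes_not_in[OF that(1), of i] that(2) by force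
  have pos: "0 < \<pi> i" if "\<pi> permutes {1..l}" "0 < i" for \<pi> i
    using permutes_in_image[OF that(1), of i] permutes_not_in[OF that(1), of i] that(2) by force
  have comp: "perm_oplus k \<sigma> \<tau> (perm_oplus k \<sigma>' \<tau>' i) = i"
    if "\<sigma>' permutes {1..k}" "\<tau>' permutes {1..l}" "\<And>i. \<sigma> (\<sigma>' i) = i" "\<And>i. \<tau> (\<tau>' i) = i"
    for \<sigma> \<tau> \<sigma>' \<tau>' i
    using le[OF that(1), of i] pos[OF that(2), of "i - k"] that(3,4) by (auto simp: perm_oplus_def)
  have "bij (perm_oplus k \<sigma> \<tau>)"
  proof (rule o_bij[where g = "perm_oplus k (inv_into UNIV \<sigma>) (inv_into UNIV \<tau>)"])
    show "perm_oplus k (inv_into UNIV \<sigma>) (inv_into UNIV \<tau>) \<circ> perm_oplus k \<sigma> \<tau> = id"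
      using comp[OF assms] permutes_inverses(2)[OF assms(1)] permutes_inverses(2)[OF assms(2)] by auto
    show "perm_oplus k \<sigma> \<tau> \<circ> perm_oplus k (inv_into UNIV \<sigma>) (inv_into UNIV \<tau>) = id"
      using comp[OF permutes_inv[OF assms(1)] permutes_inv[OF assms(2)]]
        permutes_inverses(1)[OF assms(1)] permutes_inverses(1)[OF assms(2)] by auto
  qed
  moreover have "perm_oplus k \<sigma> \<tau> i = i" if "i \<notin> {1..k + l}" for i
  proof -
    have "i \<notin> {1..k}" "i \<le> k \<or> i - k \<notin> {1..l}" using that by auto
    then show ?thesis
      using permutes_not_in[OF assms(1)] permutes_not_in[OF assms(2)] by (auto simp: perm_oplus_def)
  qed
  ultimately show ?thesis
    by (simp add: permutes_def bij_iff)
qed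

text \<open>The block sum preserves both blocks of indices, so each position reads only from its own
  list.\<close>

lemma perm_oplus_append:
  assumes "\<sigma> permutes {1..k}" "\<tau> permutes {1..l}" "length xs = k" "length ys = l"
  shows "map (\<lambda>i. (xs @ ys) ! (perm_oplus k \<sigma> \<tau> i - 1)) [1..<k + l + 1] =
    map (\<lambda>i. xs ! (\<sigma> i - 1)) [1..<k + 1] @ map (\<lambda>i. ys ! (\<tau> i - 1)) [1..<l + 1]"
proof (rule nth_equalityI)
  fix j assume "j < length (map (\<lambda>i. (xs @ ys) ! (perm_oplus k \<sigma> \<tau> i - 1)) [1..<k + l + 1])"
  then have j: "j < k + l" by (simp del: upt_Suc)
  show "map (\<lambda>i. (xs @ ys) ! (perm_oplus k \<sigma> \<tau> i - 1)) [1..<k + l + 1] ! j =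
    (map (\<lambda>i. xs ! (\<sigma> i - 1)) [1..<k + 1] @ map (\<lambda>i. ys ! (\<tau> i - 1)) [1..<l + 1]) ! j"
  proof (cases "j < k")
    case True
    then show ?thesis
      using permutes_in_image[OF assms(1), of "Suc j"] assms(3)
      by (auto simp: perm_oplus_def nth_append simp del: upt_Suc)
  next
    case False
    \<comment> \<open>Positivity of this value matters: under truncated subtraction,
      \<open>k + \<tau> (Suc (j - k)) - 1\<close> has to be \<open>k\<close> plus a position in
      \<open>ys\<close>.\<close>
    then have "\<tau> (Suc (j - k)) \<in> {1..l}"
      using permutes_in_image[OF assms(2), of "Suc (j - k)"] j by auto
    with False show ?thesis
      using j assms(3,4) by (auto simp: perm_oplus_def nth_append Suc_diff_le simp del: upt_Suc)
  qed
qed (simp del: upt_Suc)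

section \<open>The operators \<open>p_op\<close> and their convolution\<close>

context graded_bialgebra
begin

text \<open>The factor \<open>M\<^sub>\<alpha>\<^sub>,\<^sub>\<sigma> = m\<^sup>[\<^sup>k\<^sup>] \<circ> P\<^sub>\<alpha> \<circ> \<sigma>\<^sup>-\<^sup>1\<close> of \<open>p\<^sub>\<alpha>\<^sub>,\<^sub>\<sigma>\<close>.\<close>

definition project_mult :: "nat list \<Rightarrow> (nat \<Rightarrow> nat) \<Rightarrow> ('c list \<Rightarrow> 'a) set \<Rightarrow> 'c"
  where "project_mult \<alpha> \<sigma> s = iter_mult R H (length \<alpha>) (tensor_map R H (map (grade_proj H G) \<alpha>)
    (tensor_permute R H (length \<alpha>) (inv_into UNIV \<sigma>) s))"

lemma p_op_eq: "p_op R H \<Delta> \<epsilon> G \<alpha> \<sigma> x = project_mult \<alpha> \<sigma> (iter_comult R H \<Delta> \<epsilon> (length \<alpha>) x)"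
  by (simp add: p_op_def project_mult_def)

lemma grade_projs_linear: "set (map (grade_proj H G) \<alpha>) \<subseteq> linear_maps R H H"
  using grade_proj_linear by auto

lemma grade_projs_tuple:
  assumes "xs \<in> tuples H (length \<alpha>)"
  shows "map2 (\<lambda>f x. f x) (map (grade_proj H G) \<alpha>) xs \<in> tuples H (length \<alpha>)"
proof -
  have "grade_proj H G n (xs ! i) \<in> carrier H" if "i < length \<alpha>" for n i
    using assms that by (intro linear_maps_closed[OF grade_proj_linear]) (auto simp: tuples_def)
  with assms show ?thesis by (auto simp: tuples_def set_zip)
qed

lemma project_mult_linear:
  assumes "\<sigma> permutes {1..length \<alpha>}"
  shows "project_mult \<alpha> \<sigma> \<in> linear_maps R (tensor_power R H (length \<alpha>)) H"
  unfolding project_mult_def[abs_def]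
  by (rule linear_maps_compose[OF iter_mult_linear linear_maps_compose[OF
      tensor_map_linear[OF module_axioms grade_projs_linear[of \<alpha>], unfolded length_map]
      tensor_permute_inv_linear[OF module_axioms assms]]])

text \<open>Reduces compatibility with concatenation to lists: for entries x_1, ..., x_k of
  \<open>xs\<close> the right-hand side is the product p_{\<alpha>_1}(x_{\<sigma>(1)}) ...
  p_{\<alpha>_k}(x_{\<sigma>(k)}).\<close>

lemma project_mult_pure:
  assumes "\<sigma> permutes {1..length \<alpha>}" "xs \<in> tuples H (length \<alpha>)"
  shows "project_mult \<alpha> \<sigma> (pure_tensor R H xs) =
    foldr (\<lambda>x y. x \<otimes>\<^bsub>H\<^esub> y) (map2 (\<lambda>f x. f x) (map (grade_proj H G) \<alpha>)
      (map (\<lambda>i. xs ! (\<sigma> i - 1)) [1..<length \<alpha> + 1])) \<one>\<^bsub>H\<^esub>"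
proof -
  let ?ys = "map (\<lambda>i. xs ! (\<sigma> i - 1)) [1..<length \<alpha> + 1]"
  have ys: "?ys \<in> tuples H (length \<alpha>)" by (rule permuted_tuple[OF module_axioms assms])
  have "tensor_map R H (map (grade_proj H G) \<alpha>) (pure_tensor R H ?ys) =
      pure_tensor R H (map2 (\<lambda>f x. f x) (map (grade_proj H G) \<alpha>) ?ys)"
    by (rule tensor_map_pure[OF module_axioms grade_projs_linear]) (use ys in simp)
  then show ?thesis
    unfolding project_mult_def tensor_permute_inv_pure[OF module_axioms assms]
    using iter_mult_pure[OF grade_projs_tuple[OF ys]] by simp
qed

text \<open>Both sides are bilinear in \<open>s\<close> and \<open>t\<close>, so pure tensors
  suffice; for these the list of factors splits after \<open>length \<alpha>\<close> entries, and
  its product splits accordingly.\<close>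

lemma project_mult_append:
  assumes \<sigma>: "\<sigma> permutes {1..length \<alpha>}" and \<tau>: "\<tau> permutes {1..length \<beta>}"
    and s: "s \<in> carrier (tensor_power R H (length \<alpha>))"
    and t: "t \<in> carrier (tensor_power R H (length \<beta>))"
  shows "project_mult (\<alpha> @ \<beta>) (perm_oplus (length \<alpha>) \<sigma> \<tau>)
      (tensor_append R H (length \<alpha>) (length \<beta>) s t) =
    project_mult \<alpha> \<sigma> s \<otimes>\<^bsub>H\<^esub> project_mult \<beta> \<tau> t"
proof (rule tensor_bilinear_unique[OF module_axioms module_axioms _ _ _ s t])
  let ?k = "length \<alpha>" and ?l = "length \<beta>"
  have \<sigma>\<tau>: "perm_oplus ?k \<sigma> \<tau> permutes {1..length (\<alpha> @ \<beta>)}"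
    using perm_oplus_permutes[OF \<sigma> \<tau>] by simp
  show "(\<lambda>s t. project_mult (\<alpha> @ \<beta>) (perm_oplus ?k \<sigma> \<tau>) (tensor_append R H ?k ?l s t))
      \<in> bilinear_maps R (tensor_power R H ?k) (tensor_power R H ?l) H"
    using linear_bilinear_compose[OF project_mult_linear[OF \<sigma>\<tau>] tensor_append_bilinear[OF module_axioms, of ?k ?l,
        folded length_append]] .
  show "(\<lambda>s t. project_mult \<alpha> \<sigma> s \<otimes>\<^bsub>H\<^esub> project_mult \<beta> \<tau> t)
      \<in> bilinear_maps R (tensor_power R H ?k) (tensor_power R H ?l) H"
    by (rule bilinear_maps_compose[OF mult_bilinear project_mult_linear[OF \<sigma>] project_mult_linear[OF \<tau>]])
  fix xs ys assume xs: "xs \<in> tuples H ?k" and ys: "ys \<in> tuples H ?l"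
  let ?xs = "map (\<lambda>i. xs ! (\<sigma> i - 1)) [1..<?k + 1]" and ?ys = "map (\<lambda>i. ys ! (\<tau> i - 1)) [1..<?l + 1]"
  let ?fs = "\<lambda>\<alpha>. map (grade_proj H G) \<alpha>"
  have len: "length xs = ?k" "length ys = ?l" using xs ys by (auto simp: tuples_def)
  have cl: "set (map2 (\<lambda>f x. f x) (?fs \<alpha>) ?xs) \<subseteq> carrier H" "set (map2 (\<lambda>f x. f x) (?fs \<beta>) ?ys) \<subseteq> carrier H"
    using grade_projs_tuple[OF permuted_tuple[OF module_axioms \<sigma> xs]]
      grade_projs_tuple[OF permuted_tuple[OF module_axioms \<tau> ys]] by (simp_all add: tuples_def)
  have "xs @ ys \<in> tuples H (length (\<alpha> @ \<beta>))" using tuples_append[OF xs ys] by simp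
  then have "project_mult (\<alpha> @ \<beta>) (perm_oplus ?k \<sigma> \<tau>) (pure_tensor R H (xs @ ys)) =
      foldr (\<lambda>x y. x \<otimes>\<^bsub>H\<^esub> y) (map2 (\<lambda>f x. f x) (?fs (\<alpha> @ \<beta>)) (?xs @ ?ys)) \<one>\<^bsub>H\<^esub>"
    unfolding project_mult_pure[OF \<sigma>\<tau> \<open>xs @ ys \<in> _\<close>]
    by (simp only: length_append perm_oplus_append[OF \<sigma> \<tau> len])
  also have "map2 (\<lambda>f x. f x) (?fs (\<alpha> @ \<beta>)) (?xs @ ?ys) =
      map2 (\<lambda>f x. f x) (?fs \<alpha>) ?xs @ map2 (\<lambda>f x. f x) (?fs \<beta>) ?ys"
    by (simp del: upt_Suc)
  also have "foldr (\<lambda>x y. x \<otimes>\<^bsub>H\<^esub> y) \<dots> \<one>\<^bsub>H\<^esub> =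
      project_mult \<alpha> \<sigma> (pure_tensor R H xs) \<otimes>\<^bsub>H\<^esub> project_mult \<beta> \<tau> (pure_tensor R H ys)"
    unfolding foldr_mult_append[OF cl] project_mult_pure[OF \<sigma> xs] project_mult_pure[OF \<tau> ys] ..
  finally show "project_mult (\<alpha> @ \<beta>) (perm_oplus ?k \<sigma> \<tau>)
      (tensor_append R H ?k ?l (pure_tensor R H xs) (pure_tensor R H ys)) =
    project_mult \<alpha> \<sigma> (pure_tensor R H xs) \<otimes>\<^bsub>H\<^esub> project_mult \<beta> \<tau> (pure_tensor R H ys)"
    by (simp only: tensor_append_pure[OF module_axioms xs ys])
qed

text \<open>Membership in \<open>linear_maps\<close> is what \<open>tensor_map_pure\<close> asks of
  the entries when \<open>convolution\<close> forms \<open>tensor_map R H [f, g]\<close>.\<close>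

lemma p_op_linear:
  assumes "\<sigma> permutes {1..length \<alpha>}"
  shows "p_op R H \<Delta> \<epsilon> G \<alpha> \<sigma> \<in> linear_maps R H H"
  unfolding p_op_eq[abs_def]
  by (rule linear_maps_compose[OF project_mult_linear[OF assms] iter_comult_linear])

lemma convolution_p_op:
  assumes \<sigma>: "\<sigma> permutes {1..length \<alpha>}" and \<tau>: "\<tau> permutes {1..length \<beta>}" and x: "x \<in> carrier H"
  shows "convolution R H \<Delta> (p_op R H \<Delta> \<epsilon> G \<alpha> \<sigma>) (p_op R H \<Delta> \<epsilon> G \<beta> \<tau>) x =
    p_op R H \<Delta> \<epsilon> G (\<alpha> @ \<beta>) (perm_oplus (length \<alpha>) \<sigma> \<tau>) x"
proof -
  let ?k = "length \<alpha>" and ?l = "length \<beta>" and ?D = "iter_comult R H \<Delta> \<epsilon>"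
  let ?f = "p_op R H \<Delta> \<epsilon> G \<alpha> \<sigma>" and ?g = "p_op R H \<Delta> \<epsilon> G \<beta> \<tau>"
  let ?M = "project_mult (\<alpha> @ \<beta>) (perm_oplus ?k \<sigma> \<tau>)"
  \<comment> \<open>The tensor product of \<open>?D ?k\<close> and \<open>?D ?l\<close>, as a linear
    map on the second tensor power.\<close>
  let ?\<Theta> = "tensor_lift R H 2 (tensor_power R H (?k + ?l))
    (\<lambda>h. tensor_append R H ?k ?l (?D ?k (h ! 0)) (?D ?l (h ! 1)))"
  note mult = bilinear_lift[OF module_axioms module_axioms mult_bilinear]
  note app = append_lift[OF iter_comult_linear iter_comult_linear]
  have M: "?M \<in> linear_maps R (tensor_power R H (?k + ?l)) H"
    using project_mult_linear[of "perm_oplus ?k \<sigma> \<tau>" "\<alpha> @ \<beta>"] perm_oplus_permutes[OF \<sigma> \<tau>] by simp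
  have fg: "set [?f, ?g] \<subseteq> linear_maps R H H"
    using p_op_linear[OF \<sigma>] p_op_linear[OF \<tau>] by simp
  \<comment> \<open>Turns the exponent \<open>length [?f, ?g]\<close> in the facts on
    \<open>tensor_map\<close> into the 2 of the target of \<Delta>.\<close>
  have "length [?f, ?g] = 2" by simp
  note map = tensor_map[OF module_axioms fg, unfolded this]
  have "convolution R H \<Delta> ?f ?g x =
      tensor_lift R H 2 H (\<lambda>h. h ! 0 \<otimes>\<^bsub>H\<^esub> h ! 1) (tensor_map R H [?f, ?g] (\<Delta> x))"
    by (simp add: convolution_def)
  \<comment> \<open>Both sides are linear maps evaluated at \<open>\<Delta> x\<close>, so it
    suffices to compare them on the pure tensor of \<open>[a, b]\<close>, where both give the
    product of \<open>?f a\<close> and \<open>?g b\<close>.\<close>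
  also have "\<dots> = ?M (?\<Theta> (\<Delta> x))"
  proof (rule tensor_linear_unique[OF module_axioms module_axioms
        linear_maps_compose[OF mult(1) map(1)] linear_maps_compose[OF M app(1)] _
        linear_maps_closed[OF comult_linear x]])
    fix xs assume xs: "xs \<in> tuples H 2"
    then obtain a b where ab: "a \<in> carrier H" "b \<in> carrier H" "xs = [a, b]" by (rule tuples_2E)
    have "tensor_lift R H 2 H (\<lambda>h. h ! 0 \<otimes>\<^bsub>H\<^esub> h ! 1) (tensor_map R H [?f, ?g] (pure_tensor R H xs)) =
        ?f a \<otimes>\<^bsub>H\<^esub> ?g b"
      using mult(2)[OF linear_maps_closed[OF p_op_linear[OF \<sigma>] ab(1)]
          linear_maps_closed[OF p_op_linear[OF \<tau>] ab(2)]] map(2)[OF xs] ab(3)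
      by (simp del: One_nat_def)
    also have "\<dots> = ?M (tensor_append R H ?k ?l (?D ?k a) (?D ?l b))"
      unfolding p_op_eq
      by (intro project_mult_append[symmetric] \<sigma> \<tau> linear_maps_closed[OF iter_comult_linear] ab)
    finally show "tensor_lift R H 2 H (\<lambda>h. h ! 0 \<otimes>\<^bsub>H\<^esub> h ! 1)
        (tensor_map R H [?f, ?g] (pure_tensor R H xs)) = ?M (?\<Theta> (pure_tensor R H xs))"
      unfolding ab(3) app(2)[OF ab(1,2)] .
  qed
  \<comment> \<open>Coassociativity and the counit axiom enter at this point, through
    \<open>iter_comult_add\<close>.\<close>
  also have "?\<Theta> (\<Delta> x) = ?D (?k + ?l) x"
    by (simp only: iter_comult_add[OF x] comult_tensor_def)
  finally show ?thesis by (simp only: p_op_eq[of "\<alpha> @ \<beta>"] length_append)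
qed

end

text \<open>Endomorphisms of \<open>H\<close> are functions on the whole type \<open>'h\<close>, of
  which only the values on \<open>carrier H\<close> carry meaning; hence equality on the
  carrier.\<close>

theorem proposition1p15:
  fixes R :: "('k, 'r) ring_scheme" and H :: "('k, 'h, 'm) module_scheme"
    and \<Delta> :: "'h \<Rightarrow> ('h list \<Rightarrow> 'k) set" and \<epsilon> :: "'h \<Rightarrow> 'k" and G :: "nat \<Rightarrow> 'h set"
    and \<alpha> \<beta> :: "nat list" and \<sigma> \<tau> :: "nat \<Rightarrow> nat"
  assumes "graded_bialgebra R H \<Delta> \<epsilon> G"
    and "\<sigma> permutes {1..length \<alpha>}"
    and "\<tau> permutes {1..length \<beta>}"
  shows "\<forall>x\<in>carrier H.
    convolution R H \<Delta> (p_op R H \<Delta> \<epsilon> G \<alpha> \<sigma>) (p_op R H \<Delta> \<epsilon> G \<beta> \<tau>) x =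
    p_op R H \<Delta> \<epsilon> G (\<alpha> @ \<beta>) (perm_oplus (length \<alpha>) \<sigma> \<tau>) x"
  using graded_bialgebra.convolution_p_op[OF assms] by blast

end
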